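(* The functor $\iota_s:Sig_s\to\mathcal{A}n\mathcal{D}iag$ over $\mathbf{Set}$ is an equivalence of fibrations.
   Context: Notation: $[n]=\{0,\dots,n\}$, $(n]=\{1,\dots,n\}$; $S_n$ is the group of permutations of $(n]$, acting on $[n]$ with $0$ fixed. Symmetric sets. A symmetric set $(A,\alpha)$ is a family $(A_n)_{n\in\omega}$ of sets with right actions of $S_n$ on $A_n$, written $a\cdot\sigma$; $|a|=n$ for $a\in A_n$. Morphisms are families of equivariant maps; the category is $\sigma\mathbf{Set}$. For a set $O$, $\delta(O)=\omega\times O$ is the symmetric set with $\delta(O)_n=\{n\}\times O$ and trivial actions; $O^\ddagger$ is the symmetric set with $(O^\ddagger)_n=O^{[n]}$ and $d\cdot\sigma=d\circ\sigma$. Symmetric signatures. $Sig_s$ has objects $(A,\alpha,\partial^A,O)$ with $\partial^A:(A,\alpha)\to O^\ddagger$ equivariant (write $\partial^A_a:[|a|]\to O$), and morphisms $(f,u):(A,\alpha,\partial^A,O)\to(B,\beta,\partial^B,Q)$ with $f$ equivariant, $u:O\to Q$ a function and $\partial^B_{f(a)}=u\circ\partial^A_a$. The projection $p_s:Sig_s\to\mathbf{Set}$, $(f,u)\mapsto u$, is a fibration. Analytic diagrams. A pseudo-analytic diagram over $O$ is a diagram in $\sigma\mathbf{Set}$ of the form $\delta(O)\xleftarrow{s}(E,\varepsilon)\xrightarrow{p}(A,\alpha)\xrightarrow{t}\delta(O)$ with $p$ having finite fibres. A morphism $(f,g,u)$ over a function $u:O\to Q$ to $(t',p',s')$ consists of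 equivariant $f:(A,\alpha)\to(A',\alpha')$, $g:(E,\varepsilon)\to(E',\varepsilon')$ with $s'g=\delta(u)s$, $t'f=\delta(u)t$ and $p'g=fp$ a pullback square. Let $(R,\rho)$ be the symmetric set $R_n=\{n\}\times(n]$ with $\langle n,i\rangle\cdot\tau=\langle n,\tau^{-1}(i)\rangle$, and let $\mathcal{R}$ be the pseudo-analytic diagram $\delta(1)\leftarrow(R,\rho)\to\delta(1)\to\delta(1)$ ($\delta(1)$ is terminal). The category $\mathcal{A}n\mathcal{D}iag$ of analytic diagrams is the slice of the category of pseudo-analytic diagrams over $\mathcal{R}$; thus an analytic diagram is a pseudo-analytic diagram with a morphism $(E,\varepsilon)\to(R,\rho)$ exhibiting $p$ as the pullback of $(R,\rho)\to\delta(1)$ along $(A,\alpha)\to\delta(1)$, and morphisms commute with the maps to $(R,\rho)$. The projection $p_{and}:\mathcal{A}n\mathcal{D}iag\to\mathbf{Set}$ sends a diagram over $O$ to $O$. The functor $\iota_s$ sends $(A,\alpha,\partial^A,O)$ to $\delta(O)\xleftarrow{s^A}(E^A,\overline{\alpha})\xrightarrow{p^A}(A,\alpha)\xrightarrow{t^A}\delta(O)$, where $E^A=\{\langle a,i\rangle:a\in A,\ i\in(|a|]\}$, $\langle a,i\rangle\cdot\sigma=\langle a\cdot\sigma,\sigma^{-1}(i)\rangle$, $s^A(a,i)=\langle|a|,\partial^A_a(i)\rangle$, $p^A(a,i)=a$, $t^A(a)=\langle|a|,\partial^A_a(0)\rangle$, with map to $(R,\rho)$ given by $\langle a,i\rangle\mapsto\langle|a|,i\rangle$;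 it sends $(f,u)$ to $(f,\bar{f},u)$ with $\bar{f}(a,i)=\langle f(a),i\rangle$. *)

theory Defs
  imports "HOL-Library.FuncSet" "HOL-Combinatorics.Permutations"
begin

section \<open>Categories, functors and fibrations\<close>

text \<open>Arrows do not remember their domain and codomain; the composite of \<open>f : x \<rightarrow> y\<close> and
  \<open>g : y \<rightarrow> z\<close> is \<open>cmp C x y z g f\<close>.  Values of \<open>hom\<close>, \<open>idn\<close>, \<open>cmp\<close> and of the
  components of a functor matter only at objects and at arrows of the relevant hom-sets.\<close>

record ('o, 'm) cat =
  ob :: "'o set"
  hom :: "'o \<Rightarrow> 'o \<Rightarrow> 'm set"
  idn :: "'o \<Rightarrow> 'm"
  cmp :: "'o \<Rightarrow> 'o \<Rightarrow> 'o \<Rightarrow> 'm \<Rightarrow> 'm \<Rightarrow> 'm"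

definition category :: "('o, 'm) cat \<Rightarrow> bool" where
  "category C \<longleftrightarrow>
     (\<forall>x\<in>ob C. idn C x \<in> hom C x x) \<and>
     (\<forall>x\<in>ob C. \<forall>y\<in>ob C. \<forall>z\<in>ob C. \<forall>f\<in>hom C x y. \<forall>g\<in>hom C y z. cmp C x y z g f \<in> hom C x z) \<and>
     (\<forall>x\<in>ob C. \<forall>y\<in>ob C. \<forall>f\<in>hom C x y.
        cmp C x x y f (idn C x) = f \<and> cmp C x y y (idn C y) f = f) \<and>
     (\<forall>w\<in>ob C. \<forall>x\<in>ob C. \<forall>y\<in>ob C. \<forall>z\<in>ob C. \<forall>f\<in>hom C w x. \<forall>g\<in>hom C x y. \<forall>h\<in>hom C y z.
        cmp C w y z h (cmp C w x y g f) = cmp C w x z (cmp C x y z h g) f)"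

definition isomorphism :: "('o, 'm) cat \<Rightarrow> 'o \<Rightarrow> 'o \<Rightarrow> 'm \<Rightarrow> bool" where
  "isomorphism C x y f \<longleftrightarrow> f \<in> hom C x y \<and>
     (\<exists>g\<in>hom C y x. cmp C x y x g f = idn C x \<and> cmp C y x y f g = idn C y)"

text \<open>The square with sides \<open>f a = g b\<close>, where \<open>a : p \<rightarrow> x\<close>, \<open>b : p \<rightarrow> y\<close>,
  \<open>f : x \<rightarrow> z\<close> and \<open>g : y \<rightarrow> z\<close>.\<close>

definition pullback_square ::
  "('o, 'm) cat \<Rightarrow> 'o \<Rightarrow> 'o \<Rightarrow> 'o \<Rightarrow> 'o \<Rightarrow> 'm \<Rightarrow> 'm \<Rightarrow> 'm \<Rightarrow> 'm \<Rightarrow> bool" where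
  "pullback_square C p x y z a b f g \<longleftrightarrow>
     a \<in> hom C p x \<and> b \<in> hom C p y \<and> f \<in> hom C x z \<and> g \<in> hom C y z \<and>
     cmp C p x z f a = cmp C p y z g b \<and>
     (\<forall>w\<in>ob C. \<forall>c\<in>hom C w x. \<forall>d\<in>hom C w y. cmp C w x z f c = cmp C w y z g d \<longrightarrow>
        (\<exists>!h. h \<in> hom C w p \<and> cmp C w p x a h = c \<and> cmp C w p y b h = d))"

definition slice :: "('o, 'm) cat \<Rightarrow> 'o \<Rightarrow> ('o \<times> 'm, 'm) cat" where
  "slice C r = \<lparr>
     ob = {(x, h). x \<in> ob C \<and> h \<in> hom C x r},
     hom = (\<lambda>X Y. {m \<in> hom C (fst X) (fst Y). cmp C (fst X) (fst Y) r (snd Y) m = snd X}),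
     idn = (\<lambda>X. idn C (fst X)),
     cmp = (\<lambda>X Y Z. cmp C (fst X) (fst Y) (fst Z)) \<rparr>"

record ('o, 'm, 'p, 'n) func =
  fob :: "'o \<Rightarrow> 'p"
  far :: "'o \<Rightarrow> 'o \<Rightarrow> 'm \<Rightarrow> 'n"

definition is_functor :: "('o, 'm) cat \<Rightarrow> ('p, 'n) cat \<Rightarrow> ('o, 'm, 'p, 'n) func \<Rightarrow> bool" where
  "is_functor C D F \<longleftrightarrow> category C \<and> category D \<and>
     (\<forall>x\<in>ob C. fob F x \<in> ob D) \<and>
     (\<forall>x\<in>ob C. \<forall>y\<in>ob C. \<forall>f\<in>hom C x y. far F x y f \<in> hom D (fob F x) (fob F y)) \<and>
     (\<forall>x\<in>ob C. far F x x (idn C x) = idn D (fob F x)) \<and>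
     (\<forall>x\<in>ob C. \<forall>y\<in>ob C. \<forall>z\<in>ob C. \<forall>f\<in>hom C x y. \<forall>g\<in>hom C y z.
        far F x z (cmp C x y z g f) =
          cmp D (fob F x) (fob F y) (fob F z) (far F y z g) (far F x y f))"

definition id_func :: "('o, 'm, 'o, 'm) func" where
  "id_func = \<lparr> fob = (\<lambda>x. x), far = (\<lambda>x y f. f) \<rparr>"

definition comp_func ::
  "('p, 'n, 'q, 'k) func \<Rightarrow> ('o, 'm, 'p, 'n) func \<Rightarrow> ('o, 'm, 'q, 'k) func" where
  "comp_func G F = \<lparr>
     fob = (\<lambda>x. fob G (fob F x)),
     far = (\<lambda>x y f. far G (fob F x) (fob F y) (far F x y f)) \<rparr>"

definition nat_iso ::
  "('o, 'm) cat \<Rightarrow> ('p, 'n) cat \<Rightarrow> ('o, 'm, 'p, 'n) func \<Rightarrow> ('o, 'm, 'p, 'n) func \<Rightarrow> ('o \<Rightarrow> 'n) \<Rightarrow> bool"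
where
  "nat_iso C D F G \<eta> \<longleftrightarrow> is_functor C D F \<and> is_functor C D G \<and>
     (\<forall>x\<in>ob C. isomorphism D (fob F x) (fob G x) (\<eta> x)) \<and>
     (\<forall>x\<in>ob C. \<forall>y\<in>ob C. \<forall>f\<in>hom C x y.
        cmp D (fob F x) (fob F y) (fob G y) (\<eta> y) (far F x y f) =
        cmp D (fob F x) (fob G x) (fob G y) (far G x y f) (\<eta> x))"

definition cartesian ::
  "('o, 'm) cat \<Rightarrow> ('b, 'n) cat \<Rightarrow> ('o, 'm, 'b, 'n) func \<Rightarrow> 'o \<Rightarrow> 'o \<Rightarrow> 'm \<Rightarrow> bool" where
  "cartesian C B P x y f \<longleftrightarrow> f \<in> hom C x y \<and>
     (\<forall>z\<in>ob C. \<forall>g\<in>hom C z y. \<forall>w\<in>hom B (fob P z) (fob P x).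
        cmp B (fob P z) (fob P x) (fob P y) (far P x y f) w = far P z y g \<longrightarrow>
        (\<exists>!h. h \<in> hom C z x \<and> far P z x h = w \<and> cmp C z x y f h = g))"

definition fibration :: "('o, 'm) cat \<Rightarrow> ('b, 'n) cat \<Rightarrow> ('o, 'm, 'b, 'n) func \<Rightarrow> bool" where
  "fibration C B P \<longleftrightarrow> is_functor C B P \<and>
     (\<forall>y\<in>ob C. \<forall>b\<in>ob B. \<forall>u\<in>hom B b (fob P y).
        \<exists>x\<in>ob C. fob P x = b \<and> (\<exists>f. cartesian C B P x y f \<and> far P x y f = u))"

definition fibred_functor ::
  "('o, 'm) cat \<Rightarrow> ('p, 'k) cat \<Rightarrow> ('b, 'n) cat \<Rightarrow> ('o, 'm, 'b, 'n) func \<Rightarrow> ('p, 'k, 'b, 'n) func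
    \<Rightarrow> ('o, 'm, 'p, 'k) func \<Rightarrow> bool" where
  "fibred_functor C D B P Q F \<longleftrightarrow> is_functor C D F \<and>
     (\<forall>x\<in>ob C. fob Q (fob F x) = fob P x) \<and>
     (\<forall>x\<in>ob C. \<forall>y\<in>ob C. \<forall>f\<in>hom C x y. far Q (fob F x) (fob F y) (far F x y f) = far P x y f) \<and>
     (\<forall>x\<in>ob C. \<forall>y\<in>ob C. \<forall>f. cartesian C B P x y f \<longrightarrow>
        cartesian D B Q (fob F x) (fob F y) (far F x y f))"

definition vertical_nat_iso ::
  "('o, 'm) cat \<Rightarrow> ('p, 'k) cat \<Rightarrow> ('b, 'n) cat \<Rightarrow> ('p, 'k, 'b, 'n) func
    \<Rightarrow> ('o, 'm, 'p, 'k) func \<Rightarrow> ('o, 'm, 'p, 'k) func \<Rightarrow> ('o \<Rightarrow> 'k) \<Rightarrow> bool" where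
  "vertical_nat_iso C D B Q F G \<eta> \<longleftrightarrow> nat_iso C D F G \<eta> \<and>
     (\<forall>x\<in>ob C. far Q (fob F x) (fob G x) (\<eta> x) = idn B (fob Q (fob F x)))"

text \<open>An equivalence in the 2-category of fibrations over \<open>B\<close>, cartesian functors over \<open>B\<close>
  and vertical natural transformations.\<close>

definition equivalence_of_fibrations ::
  "('o, 'm) cat \<Rightarrow> ('p, 'k) cat \<Rightarrow> ('b, 'n) cat \<Rightarrow> ('o, 'm, 'b, 'n) func \<Rightarrow> ('p, 'k, 'b, 'n) func
    \<Rightarrow> ('o, 'm, 'p, 'k) func \<Rightarrow> bool" where
  "equivalence_of_fibrations C D B P Q F \<longleftrightarrow>
     fibration C B P \<and> fibration D B Q \<and> fibred_functor C D B P Q F \<and>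
     (\<exists>G. fibred_functor D C B Q P G \<and>
        (\<exists>\<eta>. vertical_nat_iso C C B P id_func (comp_func G F) \<eta>) \<and>
        (\<exists>\<epsilon>. vertical_nat_iso D D B Q (comp_func F G) id_func \<epsilon>))"


section \<open>The category of sets\<close>

text \<open>All sets are small subsets of one type \<open>'u\<close> carrying codes for ordered pairs and natural
  numbers.  The type and the notion of smallness are arbitrary up to the closure properties below,
  which hold for the elements of any Grothendieck universe containing the natural numbers, and also
  for all subsets of any infinite type (the next lemma).\<close>

record 'u univ =
  upair :: "'u \<times> 'u \<Rightarrow> 'u"
  unum :: "nat \<Rightarrow> 'u"
  usmall :: "'u set \<Rightarrow> bool"

definition set_universe :: "'u univ \<Rightarrow> bool" where
  "set_universe U \<longleftrightarrow> inj (upair U) \<and> inj (unum U) \<and>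
     (\<forall>X. finite X \<longrightarrow> usmall U X) \<and>
     (\<forall>X Y. usmall U X \<longrightarrow> Y \<subseteq> X \<longrightarrow> usmall U Y) \<and>
     (\<forall>X Y. usmall U X \<longrightarrow> usmall U Y \<longrightarrow> usmall U (upair U ` (X \<times> Y)))"

lemma set_universe_all_subsets:
  assumes "infinite (UNIV :: 'u set)"
  shows "\<exists>U :: 'u univ. set_universe U \<and> (\<forall>X. usmall U X)"
proof -
  obtain p :: "'u \<times> 'u \<Rightarrow> 'u" where "bij_betw p (UNIV \<times> UNIV) UNIV"
    using card_of_ordIso[THEN iffD2, OF card_of_Times_same_infinite[OF assms]] by blast
  then have "inj p"
    by (simp add: bij_betw_def)
  moreover obtain n :: "nat \<Rightarrow> 'u" where "inj n"
    using infinite_countable_subset[OF assms] by blast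
  ultimately have "set_universe \<lparr> upair = p, unum = n, usmall = (\<lambda>X. True) \<rparr>"
    by (simp add: set_universe_def)
  then show ?thesis
    by (intro exI[of _ "\<lparr> upair = p, unum = n, usmall = (\<lambda>X. True) \<rparr>"]) simp
qed

definition ufst :: "'u univ \<Rightarrow> 'u \<Rightarrow> 'u" where
  "ufst U e = fst (inv (upair U) e)"

definition usnd :: "'u univ \<Rightarrow> 'u \<Rightarrow> 'u" where
  "usnd U e = snd (inv (upair U) e)"

definition unat :: "'u univ \<Rightarrow> 'u \<Rightarrow> nat" where
  "unat U = inv (unum U)"

definition SetC :: "'u univ \<Rightarrow> ('u set, 'u \<Rightarrow> 'u) cat" where
  "SetC U = \<lparr>
     ob = {X. usmall U X},
     hom = (\<lambda>X Y. X \<rightarrow>\<^sub>E Y),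
     idn = (\<lambda>X. \<lambda>x\<in>X. x),
     cmp = (\<lambda>X Y Z g f. compose X g f) \<rparr>"


section \<open>Symmetric sets\<close>

text \<open>\<open>S\<^sub>n\<close>; a map that permutes \<open>{1..n}\<close> is the identity elsewhere, so it fixes \<open>0\<close>.\<close>

definition Sym :: "nat \<Rightarrow> (nat \<Rightarrow> nat) set" where
  "Sym n = {\<sigma>. \<sigma> permutes {1..n}}"

text \<open>The element type is kept arbitrary, since \<open>O\<^sup>\<ddagger>\<close> below has functions as elements.\<close>

record 'a symset =
  elts :: "nat \<Rightarrow> 'a set"
  act :: "nat \<Rightarrow> 'a \<Rightarrow> (nat \<Rightarrow> nat) \<Rightarrow> 'a"

definition symmetric_set :: "'a symset \<Rightarrow> bool" where
  "symmetric_set A \<longleftrightarrow> (\<forall>n.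
     act A n \<in> elts A n \<rightarrow>\<^sub>E (Sym n \<rightarrow>\<^sub>E elts A n) \<and>
     (\<forall>a\<in>elts A n. act A n a id = a) \<and>
     (\<forall>a\<in>elts A n. \<forall>\<sigma>\<in>Sym n. \<forall>\<tau>\<in>Sym n. act A n a (\<sigma> \<circ> \<tau>) = act A n (act A n a \<sigma>) \<tau>))"

definition symset_hom :: "'a symset \<Rightarrow> 'b symset \<Rightarrow> (nat \<Rightarrow> 'a \<Rightarrow> 'b) set" where
  "symset_hom A B = {f. \<forall>n.
     f n \<in> elts A n \<rightarrow>\<^sub>E elts B n \<and>
     (\<forall>a\<in>elts A n. \<forall>\<sigma>\<in>Sym n. f n (act A n a \<sigma>) = act B n (f n a) \<sigma>)}"

definition SymSet :: "'u univ \<Rightarrow> ('u symset, nat \<Rightarrow> 'u \<Rightarrow> 'u) cat" where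
  "SymSet U = \<lparr>
     ob = {A. symmetric_set A \<and> (\<forall>n. usmall U (elts A n))},
     hom = symset_hom,
     idn = (\<lambda>A n. \<lambda>a\<in>elts A n. a),
     cmp = (\<lambda>A B C g f n. compose (elts A n) (g n) (f n)) \<rparr>"

definition delta :: "'u univ \<Rightarrow> 'u set \<Rightarrow> 'u symset" where
  "delta U Q = \<lparr>
     elts = (\<lambda>n. {upair U (unum U n, x) | x. x \<in> Q}),
     act = (\<lambda>n. \<lambda>z\<in>{upair U (unum U n, x) | x. x \<in> Q}. \<lambda>\<sigma>\<in>Sym n. z) \<rparr>"

definition delta_map :: "'u univ \<Rightarrow> 'u set \<Rightarrow> ('u \<Rightarrow> 'u) \<Rightarrow> nat \<Rightarrow> 'u \<Rightarrow> 'u" where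
  "delta_map U Q u n = (\<lambda>z\<in>elts (delta U Q) n. upair U (unum U n, u (usnd U z)))"

definition dagger :: "'u set \<Rightarrow> (nat \<Rightarrow> 'u) symset" where
  "dagger Q = \<lparr>
     elts = (\<lambda>n. {0..n} \<rightarrow>\<^sub>E Q),
     act = (\<lambda>n. \<lambda>d\<in>({0..n} \<rightarrow>\<^sub>E Q). \<lambda>\<sigma>\<in>Sym n. d \<circ> \<sigma>) \<rparr>"


section \<open>Symmetric signatures\<close>

record 'u sig =
  s_ops :: "'u symset"
  s_typ :: "nat \<Rightarrow> 'u \<Rightarrow> nat \<Rightarrow> 'u"
  s_sorts :: "'u set"

definition Sig_s :: "'u univ \<Rightarrow> ('u sig, (nat \<Rightarrow> 'u \<Rightarrow> 'u) \<times> ('u \<Rightarrow> 'u)) cat" where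
  "Sig_s U = \<lparr>
     ob = {X. s_ops X \<in> ob (SymSet U) \<and> s_sorts X \<in> ob (SetC U) \<and>
              s_typ X \<in> symset_hom (s_ops X) (dagger (s_sorts X))},
     hom = (\<lambda>X Y. {(f, u).
              f \<in> hom (SymSet U) (s_ops X) (s_ops Y) \<and>
              u \<in> hom (SetC U) (s_sorts X) (s_sorts Y) \<and>
              (\<forall>n. \<forall>a\<in>elts (s_ops X) n. s_typ Y n (f n a) = compose {0..n} u (s_typ X n a))}),
     idn = (\<lambda>X. (idn (SymSet U) (s_ops X), idn (SetC U) (s_sorts X))),
     cmp = (\<lambda>X Y Z (g, v) (f, u).
              (cmp (SymSet U) (s_ops X) (s_ops Y) (s_ops Z) g f,
               cmp (SetC U) (s_sorts X) (s_sorts Y) (s_sorts Z) v u)) \<rparr>"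

definition p_s ::
  "('u sig, (nat \<Rightarrow> 'u \<Rightarrow> 'u) \<times> ('u \<Rightarrow> 'u), 'u set, 'u \<Rightarrow> 'u) func" where
  "p_s = \<lparr> fob = s_sorts, far = (\<lambda>X Y (f, u). u) \<rparr>"


section \<open>Analytic diagrams\<close>

record 'u diag =
  d_sorts :: "'u set"
  d_E :: "'u symset"
  d_A :: "'u symset"
  d_s :: "nat \<Rightarrow> 'u \<Rightarrow> 'u"
  d_p :: "nat \<Rightarrow> 'u \<Rightarrow> 'u"
  d_t :: "nat \<Rightarrow> 'u \<Rightarrow> 'u"

type_synonym 'u diag_map = "(nat \<Rightarrow> 'u \<Rightarrow> 'u) \<times> (nat \<Rightarrow> 'u \<Rightarrow> 'u) \<times> ('u \<Rightarrow> 'u)"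

definition PsAnDiag :: "'u univ \<Rightarrow> ('u diag, 'u diag_map) cat" where
  "PsAnDiag U = \<lparr>
     ob = {X. d_sorts X \<in> ob (SetC U) \<and> d_E X \<in> ob (SymSet U) \<and> d_A X \<in> ob (SymSet U) \<and>
              d_s X \<in> hom (SymSet U) (d_E X) (delta U (d_sorts X)) \<and>
              d_p X \<in> hom (SymSet U) (d_E X) (d_A X) \<and>
              d_t X \<in> hom (SymSet U) (d_A X) (delta U (d_sorts X)) \<and>
              (\<forall>n. \<forall>a\<in>elts (d_A X) n. finite {e \<in> elts (d_E X) n. d_p X n e = a})},
     hom = (\<lambda>X Y. {(f, g, u).
              f \<in> hom (SymSet U) (d_A X) (d_A Y) \<and>
              g \<in> hom (SymSet U) (d_E X) (d_E Y) \<and>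
              u \<in> hom (SetC U) (d_sorts X) (d_sorts Y) \<and>
              cmp (SymSet U) (d_E X) (d_E Y) (delta U (d_sorts Y)) (d_s Y) g =
                cmp (SymSet U) (d_E X) (delta U (d_sorts X)) (delta U (d_sorts Y))
                  (delta_map U (d_sorts X) u) (d_s X) \<and>
              cmp (SymSet U) (d_A X) (d_A Y) (delta U (d_sorts Y)) (d_t Y) f =
                cmp (SymSet U) (d_A X) (delta U (d_sorts X)) (delta U (d_sorts Y))
                  (delta_map U (d_sorts X) u) (d_t X) \<and>
              pullback_square (SymSet U) (d_E X) (d_E Y) (d_A X) (d_A Y) g (d_p X) (d_p Y) f}),
     idn = (\<lambda>X. (idn (SymSet U) (d_A X), idn (SymSet U) (d_E X), idn (SetC U) (d_sorts X))),
     cmp = (\<lambda>X Y Z (f', g', u') (f, g, u).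
              (cmp (SymSet U) (d_A X) (d_A Y) (d_A Z) f' f,
               cmp (SymSet U) (d_E X) (d_E Y) (d_E Z) g' g,
               cmp (SetC U) (d_sorts X) (d_sorts Y) (d_sorts Z) u' u)) \<rparr>"

text \<open>The one-element set \<open>1\<close> is the set containing just the code of \<open>0\<close>.\<close>

definition one :: "'u univ \<Rightarrow> 'u set" where
  "one U = {unum U 0}"

definition to_delta_one :: "'u univ \<Rightarrow> 'u symset \<Rightarrow> nat \<Rightarrow> 'u \<Rightarrow> 'u" where
  "to_delta_one U A n = (\<lambda>a\<in>elts A n. upair U (unum U n, unum U 0))"

definition R_set :: "'u univ \<Rightarrow> 'u symset" where
  "R_set U = \<lparr>
     elts = (\<lambda>n. {upair U (unum U n, unum U i) | i. i \<in> {1..n}}),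
     act = (\<lambda>n. \<lambda>z\<in>{upair U (unum U n, unum U i) | i. i \<in> {1..n}}. \<lambda>\<tau>\<in>Sym n.
              upair U (unum U n, unum U (inv \<tau> (unat U (usnd U z))))) \<rparr>"

definition R_diag :: "'u univ \<Rightarrow> 'u diag" where
  "R_diag U = \<lparr>
     d_sorts = one U,
     d_E = R_set U,
     d_A = delta U (one U),
     d_s = to_delta_one U (R_set U),
     d_p = to_delta_one U (R_set U),
     d_t = to_delta_one U (delta U (one U)) \<rparr>"

definition AnDiag :: "'u univ \<Rightarrow> ('u diag \<times> 'u diag_map, 'u diag_map) cat" where
  "AnDiag U = slice (PsAnDiag U) (R_diag U)"

definition p_and :: "('u diag \<times> 'u diag_map, 'u diag_map, 'u set, 'u \<Rightarrow> 'u) func" where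
  "p_and = \<lparr> fob = (\<lambda>(D, h). d_sorts D), far = (\<lambda>X Y (f, g, u). u) \<rparr>"


section \<open>The functor from symmetric signatures to analytic diagrams\<close>

definition iota_E_elts :: "'u univ \<Rightarrow> 'u symset \<Rightarrow> nat \<Rightarrow> 'u set" where
  "iota_E_elts U A n = {upair U (a, unum U i) | a i. a \<in> elts A n \<and> i \<in> {1..n}}"

definition iota_E :: "'u univ \<Rightarrow> 'u symset \<Rightarrow> 'u symset" where
  "iota_E U A = \<lparr>
     elts = iota_E_elts U A,
     act = (\<lambda>n. \<lambda>e\<in>iota_E_elts U A n. \<lambda>\<sigma>\<in>Sym n.
              upair U (act A n (ufst U e) \<sigma>, unum U (inv \<sigma> (unat U (usnd U e))))) \<rparr>"

definition iota_diag :: "'u univ \<Rightarrow> 'u sig \<Rightarrow> 'u diag" where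
  "iota_diag U X = \<lparr>
     d_sorts = s_sorts X,
     d_E = iota_E U (s_ops X),
     d_A = s_ops X,
     d_s = (\<lambda>n. \<lambda>e\<in>iota_E_elts U (s_ops X) n.
              upair U (unum U n, s_typ X n (ufst U e) (unat U (usnd U e)))),
     d_p = (\<lambda>n. \<lambda>e\<in>iota_E_elts U (s_ops X) n. ufst U e),
     d_t = (\<lambda>n. \<lambda>a\<in>elts (s_ops X) n. upair U (unum U n, s_typ X n a 0)) \<rparr>"

text \<open>The structure map to the diagram \<open>\<R>\<close>; only its component on \<open>E\<close> is not forced by the
  terminality of \<open>\<delta>(1)\<close> and \<open>1\<close>.\<close>

definition iota_str :: "'u univ \<Rightarrow> 'u sig \<Rightarrow> 'u diag_map" where
  "iota_str U X =
     (to_delta_one U (s_ops X),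
      (\<lambda>n. \<lambda>e\<in>iota_E_elts U (s_ops X) n. upair U (unum U n, usnd U e)),
      (\<lambda>x\<in>s_sorts X. unum U 0))"

definition iota_s ::
  "'u univ \<Rightarrow> ('u sig, (nat \<Rightarrow> 'u \<Rightarrow> 'u) \<times> ('u \<Rightarrow> 'u), 'u diag \<times> 'u diag_map, 'u diag_map) func" where
  "iota_s U = \<lparr>
     fob = (\<lambda>X. (iota_diag U X, iota_str U X)),
     far = (\<lambda>X Y (f, u).
              (f,
               (\<lambda>n. \<lambda>e\<in>iota_E_elts U (s_ops X) n. upair U (f n (ufst U e), usnd U e)),
               u)) \<rparr>"

end

theory Submission
  imports Defs
begin

text \<open>In a diagram over \<open>\<R>\<close> an element \<open>e\<close> of \<open>E\<close> is the same thing as the pair of \<open>a = p e\<close> and a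
  position \<open>i \<in> {1..|a|}\<close>, so \<open>s\<close> and \<open>t\<close> together amount to a typing \<open>[|a|] \<rightarrow> O\<close>, with \<open>t\<close> giving
  the value at \<open>0\<close>; equivariance of \<open>s\<close> and \<open>t\<close> is equivariance of the typing.  Hence
  \<open>\<iota>\<^sub>s\<close> is full and faithful, and every analytic diagram is isomorphic to one in its image by an
  isomorphism lying over an identity.  Such a functor over the base is an equivalence, and it carries
  cartesian lifts from its domain to its codomain, so that only \<open>p\<^sub>s\<close> has to be shown to be a
  fibration.\<close>

section \<open>Equivalences over a base\<close>

text \<open>The lift for \<open>p_s\<close> meets a question of size: an operation over a function
  \<open>u\<close> into the sorts of \<open>Y\<close> is an operation of \<open>Y\<close> together
  with a typing refined along \<open>u\<close>, and a typing is a function, whereas operations have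
  to be elements of \<open>'u\<close>. Typings are therefore coded as nested tuples, and closure of
  small sets under coded products keeps the result small. On the side of diagrams the obstacle is
  the pullback condition, which enters both the structure map to \<open>R_diag U\<close> and every
  arrow. For the structure map it gives the bijection between \<open>E\<close> and pairs of an
  operation and a position; for an arrow commuting with the structure maps it follows from that
  bijection, because source and target are pulled back from one and the same map
  \<open>R_set U\<close> to \<delta>(1). After these two reductions arrows of diagrams are handled
  pointwise. An equivalence of fibrations also asks the inverse functor to preserve cartesian
  arrows; this comes from conjugating with isomorphisms over identities, which moves a factorization
  problem between the two categories without changing its image in the base.\<close>

lemma category_rules:
  assumes "category C"
  shows "x \<in> ob C \<Longrightarrow> idn C x \<in> hom C x x"
    and "\<lbrakk>x \<in> ob C; y \<in> ob C; z \<in> ob C; f \<in> hom C x y; g \<in> hom C y z\<rbrakk> \<Longrightarrow> cmp C x y z g f \<in> hom C x z"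
    and "\<lbrakk>x \<in> ob C; y \<in> ob C; f \<in> hom C x y\<rbrakk> \<Longrightarrow> cmp C x x y f (idn C x) = f"
    and "\<lbrakk>x \<in> ob C; y \<in> ob C; f \<in> hom C x y\<rbrakk> \<Longrightarrow> cmp C x y y (idn C y) f = f"
    and "\<lbrakk>w \<in> ob C; x \<in> ob C; y \<in> ob C; z \<in> ob C; f \<in> hom C w x; g \<in> hom C x y; h \<in> hom C y z\<rbrakk>
      \<Longrightarrow> cmp C w x z (cmp C x y z h g) f = cmp C w y z h (cmp C w x y g f)"
  using assms unfolding category_def by simp_all

lemma functor_rules:
  assumes "is_functor C D F"
  shows "category C" and "category D"
    and "x \<in> ob C \<Longrightarrow> fob F x \<in> ob D"
    and "\<lbrakk>x \<in> ob C; y \<in> ob C; f \<in> hom C x y\<rbrakk> \<Longrightarrow> far F x y f \<in> hom D (fob F x) (fob F y)"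
    and "x \<in> ob C \<Longrightarrow> far F x x (idn C x) = idn D (fob F x)"
    and "\<lbrakk>x \<in> ob C; y \<in> ob C; z \<in> ob C; f \<in> hom C x y; g \<in> hom C y z\<rbrakk> \<Longrightarrow>
      far F x z (cmp C x y z g f) = cmp D (fob F x) (fob F y) (fob F z) (far F y z g) (far F x y f)"
  using assms unfolding is_functor_def by simp_all

lemma functor_id: "category A \<Longrightarrow> is_functor A A id_func"
  by (simp add: is_functor_def id_func_def category_rules)

lemma functor_comp: "is_functor A A' G \<Longrightarrow> is_functor A' A'' H \<Longrightarrow> is_functor A A'' (comp_func H G)"
  unfolding is_functor_def comp_func_def by simp

lemma cartesianD:
  assumes "cartesian C B P x y f" and "z \<in> ob C" and "g \<in> hom C z y"
    and "w \<in> hom B (fob P z) (fob P x)"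
    and "cmp B (fob P z) (fob P x) (fob P y) (far P x y f) w = far P z y g"
  shows "\<exists>!h. h \<in> hom C z x \<and> far P z x h = w \<and> cmp C z x y f h = g"
  using assms unfolding cartesian_def by blast

text \<open>Essential surjectivity is given in vertical form: each \<open>d\<close> has a chosen
  object \<open>g d\<close> in its own fibre and a chosen isomorphism \<epsilon> with inverse
  \<delta>. Here \<open>g\<close> acts on objects only; verticality of \<delta>, an action of
  \<open>g\<close> on arrows and the lifting property of \<open>Q\<close> are derived.\<close>

locale vertical_equivalence =
  fixes C :: "('o, 'm) cat" and D :: "('p, 'k) cat" and B :: "('b, 'n) cat"
    and P :: "('o, 'm, 'b, 'n) func" and Q :: "('p, 'k, 'b, 'n) func"
    and F :: "('o, 'm, 'p, 'k) func"
    and g :: "'p \<Rightarrow> 'o" and \<epsilon> \<delta> :: "'p \<Rightarrow> 'k"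
  assumes fibration_P: "fibration C B P"
    and functor_Q: "is_functor D B Q"
    and functor_F: "is_functor C D F"
    and over_ob [simp]: "x \<in> ob C \<Longrightarrow> fob Q (fob F x) = fob P x"
    and over_ar [simp]: "\<lbrakk>x \<in> ob C; y \<in> ob C; f \<in> hom C x y\<rbrakk> \<Longrightarrow>
      far Q (fob F x) (fob F y) (far F x y f) = far P x y f"
    and full: "\<lbrakk>x \<in> ob C; y \<in> ob C; k \<in> hom D (fob F x) (fob F y)\<rbrakk> \<Longrightarrow> \<exists>h\<in>hom C x y. far F x y h = k"
    and faithful: "\<lbrakk>x \<in> ob C; y \<in> ob C; h \<in> hom C x y; h' \<in> hom C x y; far F x y h = far F x y h'\<rbrakk> \<Longrightarrow> h = h'"
    and g_ob [simp]: "d \<in> ob D \<Longrightarrow> g d \<in> ob C"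
    and g_over [simp]: "d \<in> ob D \<Longrightarrow> fob P (g d) = fob Q d"
    and \<epsilon>_hom [simp]: "d \<in> ob D \<Longrightarrow> \<epsilon> d \<in> hom D (fob F (g d)) d"
    and \<delta>_hom [simp]: "d \<in> ob D \<Longrightarrow> \<delta> d \<in> hom D d (fob F (g d))"
    and \<epsilon>\<delta> [simp]: "d \<in> ob D \<Longrightarrow> cmp D d (fob F (g d)) d (\<epsilon> d) (\<delta> d) = idn D d"
    and \<delta>\<epsilon> [simp]: "d \<in> ob D \<Longrightarrow>
      cmp D (fob F (g d)) d (fob F (g d)) (\<delta> d) (\<epsilon> d) = idn D (fob F (g d))"
    and \<epsilon>_vertical [simp]: "d \<in> ob D \<Longrightarrow> far Q (fob F (g d)) d (\<epsilon> d) = idn B (fob Q d)"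
begin

lemma functor_P: "is_functor C B P"
  using fibration_P by (simp add: fibration_def)

lemmas catC [simp] = functor_rules(1)[OF functor_P]
lemmas catB [simp] = functor_rules(2)[OF functor_P]
lemmas catD [simp] = functor_rules(1)[OF functor_Q]
lemmas [simp] = category_rules[OF catC] category_rules[OF catB] category_rules[OF catD]
  functor_rules(3-6)[OF functor_P] functor_rules(3-6)[OF functor_Q] functor_rules(3-6)[OF functor_F]

text \<open>Composites are normalised by nesting to the right, where \<epsilon> after \<delta> no
  longer appears as a subterm; this variant cancels the pair in that normal form.\<close>

lemma \<epsilon>\<delta>_cancel [simp]:
  assumes "d \<in> ob D" "z \<in> ob D" "f \<in> hom D z d"
  shows "cmp D z (fob F (g d)) d (\<epsilon> d) (cmp D z d (fob F (g d)) (\<delta> d) f) = f"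
proof -
  have "cmp D z (fob F (g d)) d (\<epsilon> d) (cmp D z d (fob F (g d)) (\<delta> d) f)
      = cmp D z d d (cmp D d (fob F (g d)) d (\<epsilon> d) (\<delta> d)) f"
    using assms by (simp del: \<epsilon>\<delta>)
  then show ?thesis using assms by simp
qed

lemma \<delta>\<epsilon>_cancel [simp]:
  assumes "d \<in> ob D" "z \<in> ob D" "f \<in> hom D z (fob F (g d))"
  shows "cmp D z d (fob F (g d)) (\<delta> d) (cmp D z (fob F (g d)) d (\<epsilon> d) f) = f"
proof -
  have "cmp D z d (fob F (g d)) (\<delta> d) (cmp D z (fob F (g d)) d (\<epsilon> d) f)
      = cmp D z (fob F (g d)) (fob F (g d)) (cmp D (fob F (g d)) d (fob F (g d)) (\<delta> d) (\<epsilon> d)) f"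
    using assms by (simp del: \<delta>\<epsilon>)
  then show ?thesis using assms by simp
qed

text \<open>\<open>Q\<close> sends \<epsilon> after \<delta> to an identity and \<epsilon> itself to
  an identity, which leaves an identity for \<delta>.\<close>

lemma \<delta>_vertical [simp]:
  assumes d: "d \<in> ob D"
  shows "far Q d (fob F (g d)) (\<delta> d) = idn B (fob Q d)"
proof -
  have hom: "far Q d (fob F (g d)) (\<delta> d) \<in> hom B (fob Q d) (fob Q d)"
    using functor_rules(4)[OF functor_Q d _ \<delta>_hom[OF d]] d by simp
  have "far Q d d (cmp D d (fob F (g d)) d (\<epsilon> d) (\<delta> d))
      = cmp B (fob Q d) (fob Q d) (fob Q d) (idn B (fob Q d)) (far Q d (fob F (g d)) (\<delta> d))"
    using d by (simp del: \<epsilon>\<delta>)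
  then show ?thesis using d hom by simp
qed

text \<open>Faithfulness makes the chosen arrow the only one, so \<open>lift x y\<close> inverts the
  bijection \<open>far F x y\<close> of hom-sets.\<close>

definition lift :: "'o \<Rightarrow> 'o \<Rightarrow> 'k \<Rightarrow> 'm" where
  "lift x y k = (SOME h. h \<in> hom C x y \<and> far F x y h = k)"

lemma lift [simp]:
  assumes "x \<in> ob C" "y \<in> ob C" "k \<in> hom D (fob F x) (fob F y)"
  shows "lift x y k \<in> hom C x y" and "far F x y (lift x y k) = k"
  using someI_ex[of "\<lambda>h. h \<in> hom C x y \<and> far F x y h = k"] full[OF assms]
  unfolding lift_def by auto

lemma lift_over [simp]:
  assumes "x \<in> ob C" "y \<in> ob C" "k \<in> hom D (fob F x) (fob F y)"
  shows "far P x y (lift x y k) = far Q (fob F x) (fob F y) k"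
  using over_ar[of x y "lift x y k"] assms by simp

text \<open>A test object \<open>z\<close> of \<open>D\<close> need not be a value of
  \<open>F\<close>, but \<epsilon> identifies it with \<open>fob F (g z)\<close>. A factorization
  problem from \<open>z\<close> thus becomes one in \<open>C\<close> from \<open>g z\<close>, with
  the same data in the base since \<epsilon> and \<delta> are vertical.\<close>

lemma cartesian_F:
  assumes x: "x \<in> ob C" and y: "y \<in> ob C" and f: "cartesian C B P x y f"
  shows "cartesian D B Q (fob F x) (fob F y) (far F x y f)"
proof -
  have fh [simp]: "f \<in> hom C x y" using f by (simp add: cartesian_def)
  note [simp] = x y
  have "\<exists>!h. h \<in> hom D z (fob F x) \<and> far Q z (fob F x) h = w \<and>
          cmp D z (fob F x) (fob F y) (far F x y f) h = k"
    if z [simp]: "z \<in> ob D" and k [simp]: "k \<in> hom D z (fob F y)"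
      and w: "w \<in> hom B (fob Q z) (fob P x)"
      and eq: "cmp B (fob Q z) (fob P x) (fob P y) (far P x y f) w = far Q z (fob F y) k"
    for z k w
  proof -
    \<comment> \<open>Precomposed with \<epsilon>, the test arrow \<open>k\<close> starts at a value
      of \<open>F\<close> and so comes from an arrow of \<open>C\<close>.\<close>
    define l where "l = lift (g z) y (cmp D (fob F (g z)) z (fob F y) k (\<epsilon> z))"
    have l [simp]: "l \<in> hom C (g z) y"
        "far F (g z) y l = cmp D (fob F (g z)) z (fob F y) k (\<epsilon> z)"
      unfolding l_def by simp_all
    have Qk: "far Q z (fob F y) k \<in> hom B (fob Q z) (fob P y)"
      using functor_rules(4)[OF functor_Q z _ k] by simp
    have "far P (g z) y l = far Q z (fob F y) k"
      using over_ar[of "g z" y l] Qk by (simp del: over_ar)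
    then have ex1: "\<exists>!h. h \<in> hom C (g z) x \<and> far P (g z) x h = w \<and> cmp C (g z) x y f h = l"
      by (intro cartesianD[OF f]) (use w eq in simp_all)
    then obtain h where h [simp]: "h \<in> hom C (g z) x" and hw: "far P (g z) x h = w"
      and hl: "cmp C (g z) x y f h = l" by blast
    show ?thesis
    proof (rule ex1I[of _ "cmp D z (fob F (g z)) (fob F x) (far F (g z) x h) (\<delta> z)"], intro conjI)
      show "cmp D z (fob F (g z)) (fob F x) (far F (g z) x h) (\<delta> z) \<in> hom D z (fob F x)"
        by simp
      show "far Q z (fob F x) (cmp D z (fob F (g z)) (fob F x) (far F (g z) x h) (\<delta> z)) = w"
        using w by (simp add: hw)
      have "cmp D (fob F (g z)) (fob F x) (fob F y) (far F x y f) (far F (g z) x h) =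
          cmp D (fob F (g z)) z (fob F y) k (\<epsilon> z)"
        using functor_rules(6)[OF functor_F _ x y h fh] by (simp add: hl)
      then have "cmp D z (fob F (g z)) (fob F y)
            (cmp D (fob F (g z)) (fob F x) (fob F y) (far F x y f) (far F (g z) x h)) (\<delta> z) =
          cmp D z (fob F (g z)) (fob F y) (cmp D (fob F (g z)) z (fob F y) k (\<epsilon> z)) (\<delta> z)"
        by simp
      then show "cmp D z (fob F x) (fob F y) (far F x y f)
          (cmp D z (fob F (g z)) (fob F x) (far F (g z) x h) (\<delta> z)) = k"
        by simp
    next
      fix h' assume "h' \<in> hom D z (fob F x) \<and> far Q z (fob F x) h' = w \<and>
          cmp D z (fob F x) (fob F y) (far F x y f) h' = k"
      then have h' [simp]: "h' \<in> hom D z (fob F x)" and h'w: "far Q z (fob F x) h' = w"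
        and h'k: "cmp D z (fob F x) (fob F y) (far F x y f) h' = k" by auto
      \<comment> \<open>A competitor is carried to \<open>C\<close> in the same way; faithfulness
        shows that its lift \<open>j\<close> solves the problem there, so it equals
        \<open>h\<close>, and \<delta> takes it back.\<close>
      define j where "j = lift (g z) x (cmp D (fob F (g z)) z (fob F x) h' (\<epsilon> z))"
      have j [simp]: "j \<in> hom C (g z) x"
          "far F (g z) x j = cmp D (fob F (g z)) z (fob F x) h' (\<epsilon> z)"
        unfolding j_def by simp_all
      have "far P (g z) x j = w"
        using over_ar[of "g z" x j] w by (simp add: h'w del: over_ar)
      moreover have "cmp C (g z) x y f j = l"
        by (rule faithful[of "g z" y]) (simp_all add: h'k flip: category_rules(5)[OF catD])
      ultimately have "j = h"
        using ex1 h hw hl j(1) by blast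
      then have "far F (g z) x h = cmp D (fob F (g z)) z (fob F x) h' (\<epsilon> z)" using j(2) by simp
      then show "h' = cmp D z (fob F (g z)) (fob F x) (far F (g z) x h) (\<delta> z)" by simp
    qed
  qed
  then show ?thesis unfolding cartesian_def by simp
qed

text \<open>The arrow part is forced: naturality of \<epsilon> requires \<open>F\<close> to send the
  image of \<open>f\<close> to the conjugate of \<open>f\<close> by \<epsilon> and \<delta>.\<close>

definition quasi_inverse :: "('p, 'k, 'o, 'm) func" where
  "quasi_inverse = \<lparr> fob = g, far = (\<lambda>d e f. lift (g d) (g e)
     (cmp D (fob F (g d)) e (fob F (g e)) (\<delta> e) (cmp D (fob F (g d)) d e f (\<epsilon> d)))) \<rparr>"

lemma quasi_inverse_simps [simp]:
  "fob quasi_inverse d = g d"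
  "\<lbrakk>d \<in> ob D; e \<in> ob D; f \<in> hom D d e\<rbrakk> \<Longrightarrow> far quasi_inverse d e f \<in> hom C (g d) (g e)"
  "\<lbrakk>d \<in> ob D; e \<in> ob D; f \<in> hom D d e\<rbrakk> \<Longrightarrow> far F (g d) (g e) (far quasi_inverse d e f) =
     cmp D (fob F (g d)) e (fob F (g e)) (\<delta> e) (cmp D (fob F (g d)) d e f (\<epsilon> d))"
  by (simp_all add: quasi_inverse_def)

lemma quasi_inverse_over [simp]:
  assumes d: "d \<in> ob D" and e: "e \<in> ob D" and f: "f \<in> hom D d e"
  shows "far P (g d) (g e) (far quasi_inverse d e f) = far Q d e f"
  using over_ar[of "g d" "g e" "far quasi_inverse d e f"] d e f functor_rules(4)[OF functor_Q d e f]
  by (simp del: over_ar)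

lemma functor_inverse: "is_functor D C quasi_inverse"
  unfolding is_functor_def
proof (intro conjI ballI)
  fix x assume "x \<in> ob D"
  then show "far quasi_inverse x x (idn D x) = idn C (fob quasi_inverse x)"
    by (intro faithful[of "g x" "g x"]) simp_all
next
  fix x y z f k assume "x \<in> ob D" "y \<in> ob D" "z \<in> ob D" "f \<in> hom D x y" "k \<in> hom D y z"
  then show "far quasi_inverse x z (cmp D x y z k f) =
      cmp C (fob quasi_inverse x) (fob quasi_inverse y) (fob quasi_inverse z) (far quasi_inverse y z k) (far quasi_inverse x y f)"
    by (intro faithful[of "g x" "g z"]) simp_all
qed simp_all

text \<open>A test object \<open>z\<close> of \<open>C\<close> is tested through
  \<open>fob F z\<close>. The isomorphism \<epsilon> replaces the target \<open>fob F (g y)\<close>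
  by \<open>y\<close>, the factorization is found in \<open>D\<close>, and \<delta> moves its end
  from \<open>x\<close> to \<open>fob F (g x)\<close> before it is lifted.\<close>

lemma cartesian_inverse:
  assumes x: "x \<in> ob D" and y: "y \<in> ob D" and f: "cartesian D B Q x y f"
  shows "cartesian C B P (g x) (g y) (far quasi_inverse x y f)"
proof -
  have fh [simp]: "f \<in> hom D x y" using f by (simp add: cartesian_def)
  note [simp] = x y
  have "\<exists>!h. h \<in> hom C z (g x) \<and> far P z (g x) h = w \<and>
          cmp C z (g x) (g y) (far quasi_inverse x y f) h = k"
    if z [simp]: "z \<in> ob C" and k [simp]: "k \<in> hom C z (g y)"
      and w: "w \<in> hom B (fob P z) (fob Q x)"
      and eq: "cmp B (fob P z) (fob Q x) (fob Q y) (far Q x y f) w = far P z (g y) k"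
    for z k w
  proof -
    let ?k = "cmp D (fob F z) (fob F (g y)) y (\<epsilon> y) (far F z (g y) k)"
    have Pk: "far P z (g y) k \<in> hom B (fob P z) (fob Q y)"
      using functor_rules(4)[OF functor_P z _ k] by simp
    have "\<exists>!h. h \<in> hom D (fob F z) x \<and> far Q (fob F z) x h = w \<and> cmp D (fob F z) x y f h = ?k"
      by (intro cartesianD[OF f]) (use w eq Pk in simp_all)
    then obtain h where h [simp]: "h \<in> hom D (fob F z) x" and hw: "far Q (fob F z) x h = w"
      and hk: "cmp D (fob F z) x y f h = ?k"
      and uniq: "\<And>h'. h' \<in> hom D (fob F z) x \<Longrightarrow> far Q (fob F z) x h' = w \<Longrightarrow>
         cmp D (fob F z) x y f h' = ?k \<Longrightarrow> h' = h"
      by blast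
    show ?thesis
    proof (rule ex1I[of _ "lift z (g x) (cmp D (fob F z) x (fob F (g x)) (\<delta> x) h)"], intro conjI)
      show "lift z (g x) (cmp D (fob F z) x (fob F (g x)) (\<delta> x) h) \<in> hom C z (g x)"
        by simp
      show "far P z (g x) (lift z (g x) (cmp D (fob F z) x (fob F (g x)) (\<delta> x) h)) = w"
        using w by (simp add: hw)
      show "cmp C z (g x) (g y) (far quasi_inverse x y f)
          (lift z (g x) (cmp D (fob F z) x (fob F (g x)) (\<delta> x) h)) = k"
        by (rule faithful[of z "g y"]) (simp_all add: hk)
    next
      fix j assume "j \<in> hom C z (g x) \<and> far P z (g x) j = w \<and>
          cmp C z (g x) (g y) (far quasi_inverse x y f) j = k"
      then have j [simp]: "j \<in> hom C z (g x)" and jw: "far P z (g x) j = w"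
        and jk: "cmp C z (g x) (g y) (far quasi_inverse x y f) j = k" by auto
      have "far F z (g y) (cmp C z (g x) (g y) (far quasi_inverse x y f) j) = far F z (g y) k"
        by (simp add: jk)
      \<comment> \<open>Postcomposing with \<epsilon> cancels the \<delta> inside the image of
        \<open>quasi_inverse\<close>, so the competitor yields a factorization of \<open>?k\<close>
        through \<open>f\<close>.\<close>
      then have "cmp D (fob F z) (fob F (g y)) y (\<epsilon> y)
          (far F z (g y) (cmp C z (g x) (g y) (far quasi_inverse x y f) j)) = ?k" by simp
      then have "cmp D (fob F z) (fob F (g x)) x (\<epsilon> x) (far F z (g x) j) = h"
        using w by (intro uniq) (simp_all add: jw)
      then have "cmp D (fob F z) x (fob F (g x)) (\<delta> x) h = far F z (g x) j"
        by auto
      then show "j = lift z (g x) (cmp D (fob F z) x (fob F (g x)) (\<delta> x) h)"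
        by (intro faithful[of z "g x"]) simp_all
    qed
  qed
  then show ?thesis unfolding cartesian_def by simp
qed

text \<open>A cartesian lift of \<open>u : b \<rightarrow> Q y\<close> is the image under \<open>F\<close> of a lift into \<open>g y\<close>, followed by \<open>\<epsilon> y\<close>.\<close>

lemma fibration_Q: "fibration D B Q"
proof -
  have "\<exists>x\<in>ob D. fob Q x = b \<and> (\<exists>f. cartesian D B Q x y f \<and> far Q x y f = u)"
    if y [simp]: "y \<in> ob D" and b [simp]: "b \<in> ob B" and u [simp]: "u \<in> hom B b (fob Q y)" for y b u
  proof -
    obtain x f where x [simp]: "x \<in> ob C" and xb [simp]: "fob P x = b"
      and f: "cartesian C B P x (g y) f" and fu: "far P x (g y) f = u"
      using fibration_P y b u unfolding fibration_def by (metis g_ob g_over)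
    have fh [simp]: "f \<in> hom C x (g y)" using f by (simp add: cartesian_def)
    let ?m = "cmp D (fob F x) (fob F (g y)) y (\<epsilon> y) (far F x (g y) f)"
    have m: "far Q (fob F x) y ?m = u" by (simp add: fu)
    have "\<exists>!h. h \<in> hom D z (fob F x) \<and> far Q z (fob F x) h = w \<and> cmp D z (fob F x) y ?m h = k"
      if z [simp]: "z \<in> ob D" and k [simp]: "k \<in> hom D z y" and w: "w \<in> hom B (fob Q z) b"
        and eq: "cmp B (fob Q z) b (fob Q y) u w = far Q z y k" for z k w
    proof -
      have Qk: "far Q z y k \<in> hom B (fob Q z) (fob Q y)"
        by simp
      have "\<exists>!h. h \<in> hom D z (fob F x) \<and> far Q z (fob F x) h = w \<and>
          cmp D z (fob F x) (fob F (g y)) (far F x (g y) f) h = cmp D z y (fob F (g y)) (\<delta> y) k"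
        by (intro cartesianD[OF cartesian_F[OF x _ f]]) (use w eq Qk in \<open>simp_all add: fu\<close>)
      \<comment> \<open>Since \<epsilon> at \<open>y\<close> is invertible, factoring
        \<open>k\<close> through \<open>?m\<close> is the same as factoring \<delta> after
        \<open>k\<close> through the image of \<open>f\<close>.\<close>
      moreover have "cmp D z (fob F x) (fob F (g y)) (far F x (g y) f) h =
            cmp D z y (fob F (g y)) (\<delta> y) k \<longleftrightarrow> cmp D z (fob F x) y ?m h = k"
        if [simp]: "h \<in> hom D z (fob F x)" for h
        by auto
      ultimately show ?thesis by (metis (no_types, lifting))
    qed
    then have "cartesian D B Q (fob F x) y ?m"
      unfolding cartesian_def m by simp
    then show ?thesis using m by (metis functor_rules(3)[OF functor_F x] over_ob[OF x] xb)
  qed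
  then show ?thesis using functor_Q unfolding fibration_def by blast
qed

lemma counit: "vertical_nat_iso D D B Q (comp_func F quasi_inverse) id_func \<epsilon>"
  unfolding vertical_nat_iso_def nat_iso_def
proof (intro conjI ballI)
  show "is_functor D D (comp_func F quasi_inverse)"
    by (rule functor_comp[OF functor_inverse functor_F])
  show "is_functor D D id_func" by (simp add: functor_id)
next
  fix d assume "d \<in> ob D"
  then show "isomorphism D (fob (comp_func F quasi_inverse) d) (fob id_func d) (\<epsilon> d)"
    by (auto simp: isomorphism_def comp_func_def id_func_def intro!: bexI[of _ "\<delta> d"])
qed (simp_all add: comp_func_def id_func_def)

text \<open>At \<open>x\<close> the arrow \<delta> of \<open>fob F x\<close> runs between two values
  of \<open>F\<close>, so it lifts to \<open>C\<close>, and the lift of \<epsilon> is its inverse.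
  The equations are checked after applying \<open>F\<close>, by faithfulness.\<close>

lemma unit: "vertical_nat_iso C C B P id_func (comp_func quasi_inverse F)
    (\<lambda>x. lift x (g (fob F x)) (\<delta> (fob F x)))"
  unfolding vertical_nat_iso_def nat_iso_def
proof (intro conjI ballI)
  show "is_functor C C (comp_func quasi_inverse F)"
    by (rule functor_comp[OF functor_F functor_inverse])
  show "is_functor C C id_func" by (simp add: functor_id)
next
  fix x assume [simp]: "x \<in> ob C"
  have "cmp C x (g (fob F x)) x (lift (g (fob F x)) x (\<epsilon> (fob F x)))
      (lift x (g (fob F x)) (\<delta> (fob F x))) = idn C x"
    by (rule faithful[of x x]) simp_all
  moreover have "cmp C (g (fob F x)) x (g (fob F x)) (lift x (g (fob F x)) (\<delta> (fob F x)))
      (lift (g (fob F x)) x (\<epsilon> (fob F x))) = idn C (g (fob F x))"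
    by (rule faithful[of "g (fob F x)" "g (fob F x)"]) simp_all
  ultimately show "isomorphism C (fob id_func x) (fob (comp_func quasi_inverse F) x)
      (lift x (g (fob F x)) (\<delta> (fob F x)))"
    by (auto simp: isomorphism_def comp_func_def id_func_def
        intro!: bexI[of _ "lift (g (fob F x)) x (\<epsilon> (fob F x))"])
next
  fix x y f assume [simp]: "x \<in> ob C" "y \<in> ob C" "f \<in> hom C x y"
  show "cmp C (fob id_func x) (fob id_func y) (fob (comp_func quasi_inverse F) y)
      (lift y (g (fob F y)) (\<delta> (fob F y))) (far id_func x y f) =
    cmp C (fob id_func x) (fob (comp_func quasi_inverse F) x) (fob (comp_func quasi_inverse F) y)
      (far (comp_func quasi_inverse F) x y f) (lift x (g (fob F x)) (\<delta> (fob F x)))"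
    by (rule faithful[of x "g (fob F y)"]) (simp_all add: comp_func_def id_func_def)
qed (simp add: comp_func_def id_func_def)

lemma equivalence_of_fibrations: "equivalence_of_fibrations C D B P Q F"
  unfolding equivalence_of_fibrations_def
proof (intro conjI exI)
  show "fibred_functor C D B P Q F"
    by (simp add: fibred_functor_def functor_F cartesian_F)
  show "fibred_functor D C B Q P quasi_inverse"
    by (simp add: fibred_functor_def functor_inverse cartesian_inverse)
qed (rule fibration_P fibration_Q unit counit)+

end

section \<open>Sets and symmetric sets\<close>

lemma Sym_closed [simp]:
  "id \<in> Sym n"
  "\<sigma> \<in> Sym n \<Longrightarrow> \<tau> \<in> Sym n \<Longrightarrow> \<sigma> \<circ> \<tau> \<in> Sym n"
  "\<sigma> \<in> Sym n \<Longrightarrow> inv \<sigma> \<in> Sym n"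
  by (auto simp: Sym_def permutes_id permutes_compose permutes_inv)

lemma Sym_rules:
  assumes "\<sigma> \<in> Sym n"
  shows "\<sigma> 0 = 0" and "\<sigma> i \<in> {1..n} \<longleftrightarrow> i \<in> {1..n}" and "\<sigma> i \<in> {0..n} \<longleftrightarrow> i \<in> {0..n}"
    and "\<sigma> (inv \<sigma> i) = i" and "inv \<sigma> (\<sigma> i) = i"
proof -
  have \<sigma>: "\<sigma> permutes {1..n}" using assms by (simp add: Sym_def)
  show "\<sigma> 0 = 0" and "\<sigma> i \<in> {1..n} \<longleftrightarrow> i \<in> {1..n}"
    using permutes_not_in[OF \<sigma>] permutes_in_image[OF \<sigma>] by simp_all
  show "\<sigma> i \<in> {0..n} \<longleftrightarrow> i \<in> {0..n}"
    by (rule permutes_in_image, rule permutes_subset[OF \<sigma>]) simp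
  show "\<sigma> (inv \<sigma> i) = i" and "inv \<sigma> (\<sigma> i) = i"
    using permutes_inverses[OF \<sigma>] by simp_all
qed

lemma inv_Sym_image: "\<sigma> \<in> Sym n \<Longrightarrow> inv \<sigma> i \<in> {1..n} \<longleftrightarrow> i \<in> {1..n}"
  by (intro Sym_rules(2)) simp

lemma inv_Sym_comp: "\<sigma> \<in> Sym n \<Longrightarrow> \<tau> \<in> Sym n \<Longrightarrow> inv (\<sigma> \<circ> \<tau>) = inv \<tau> \<circ> inv \<sigma>"
  by (auto simp: Sym_def intro!: o_inv_distrib permutes_bij)

lemma symmetric_set_rules:
  assumes "symmetric_set A" and "a \<in> elts A n"
  shows "\<sigma> \<in> Sym n \<Longrightarrow> act A n a \<sigma> \<in> elts A n"
    and "act A n a id = a"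
    and "\<sigma> \<in> Sym n \<Longrightarrow> \<tau> \<in> Sym n \<Longrightarrow> act A n a (\<sigma> \<circ> \<tau>) = act A n (act A n a \<sigma>) \<tau>"
  using assms unfolding symmetric_set_def by (auto simp: PiE_iff)

lemma symmetric_setI:
  assumes "\<And>n a \<sigma>. a \<in> E n \<Longrightarrow> \<sigma> \<in> Sym n \<Longrightarrow> ac n a \<sigma> \<in> E n"
    and "\<And>n a. a \<in> E n \<Longrightarrow> ac n a id = a"
    and "\<And>n a \<sigma> \<tau>. a \<in> E n \<Longrightarrow> \<sigma> \<in> Sym n \<Longrightarrow> \<tau> \<in> Sym n \<Longrightarrow> ac n a (\<sigma> \<circ> \<tau>) = ac n (ac n a \<sigma>) \<tau>"
  shows "symmetric_set \<lparr> elts = E, act = (\<lambda>n. \<lambda>a\<in>E n. \<lambda>\<sigma>\<in>Sym n. ac n a \<sigma>) \<rparr>"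
  using assms unfolding symmetric_set_def by auto

lemma symset_hom_iff:
  "f \<in> symset_hom A B \<longleftrightarrow>
     (\<forall>n. f n \<in> extensional (elts A n)) \<and> (\<forall>n. \<forall>a\<in>elts A n. f n a \<in> elts B n) \<and>
     (\<forall>n. \<forall>a\<in>elts A n. \<forall>\<sigma>\<in>Sym n. f n (act A n a \<sigma>) = act B n (f n a) \<sigma>)"
  unfolding symset_hom_def by (auto simp: PiE_iff)

lemma symset_hom_rules:
  assumes "f \<in> symset_hom A B" and "a \<in> elts A n"
  shows "f n a \<in> elts B n"
    and "\<sigma> \<in> Sym n \<Longrightarrow> f n (act A n a \<sigma>) = act B n (f n a) \<sigma>"
  using assms by (auto simp: symset_hom_iff)

lemma symset_hom_eqI:
  assumes "f \<in> symset_hom A B" "f' \<in> symset_hom A B'"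
    and "\<And>n a. a \<in> elts A n \<Longrightarrow> f n a = f' n a"
  shows "f = f'"
proof (rule ext)
  show "f n = f' n" for n
    using assms by (intro extensionalityI[of _ "elts A n"]) (auto simp: symset_hom_iff)
qed

lemma SetC_simps [simp]:
  "X \<in> ob (SetC U) \<longleftrightarrow> usmall U X"
  "hom (SetC U) X Y = X \<rightarrow>\<^sub>E Y"
  "x \<in> X \<Longrightarrow> idn (SetC U) X x = x"
  "x \<in> X \<Longrightarrow> cmp (SetC U) X Y Z g f x = g (f x)"
  "x \<notin> X \<Longrightarrow> idn (SetC U) X x = undefined"
  "x \<notin> X \<Longrightarrow> cmp (SetC U) X Y Z g f x = undefined"
  by (auto simp: SetC_def compose_def)

lemma category_SetC: "category (SetC U)"
  unfolding category_def SetC_def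
  by (auto simp: PiE_def compose_Id Id_compose compose_assoc Pi_iff compose_eq)

lemma SymSet_simps [simp]:
  "A \<in> ob (SymSet U) \<longleftrightarrow> symmetric_set A \<and> (\<forall>n. usmall U (elts A n))"
  "hom (SymSet U) A B = symset_hom A B"
  "a \<in> elts A n \<Longrightarrow> idn (SymSet U) A n a = a"
  "a \<in> elts A n \<Longrightarrow> cmp (SymSet U) A B C g f n a = g n (f n a)"
  "cmp (SymSet U) A B C g f n \<in> extensional (elts A n)"
  "idn (SymSet U) A n \<in> extensional (elts A n)"
  by (auto simp: SymSet_def compose_def)

text \<open>Composites are by definition \<open>undefined\<close> off the elements of
  \<open>A\<close>, so agreement on elements is equality, whatever the intermediate and final
  objects are.\<close>

lemma SymSet_cmp_eq_iff:
  "cmp (SymSet U) A B C g f = cmp (SymSet U) A B' C' g' f' \<longleftrightarrow>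
     (\<forall>n. \<forall>a\<in>elts A n. g n (f n a) = g' n (f' n a))"
  by (auto simp: SymSet_def compose_def fun_eq_iff)

lemma idn_symset_hom: "symmetric_set A \<Longrightarrow> idn (SymSet U) A \<in> symset_hom A A"
  by (auto simp: symset_hom_iff symmetric_set_rules)

lemma cmp_symset_hom:
  "symmetric_set A \<Longrightarrow> f \<in> symset_hom A B \<Longrightarrow> g \<in> symset_hom B C \<Longrightarrow>
   cmp (SymSet U) A B C g f \<in> symset_hom A C"
  by (auto simp: symset_hom_iff symmetric_set_rules)

lemma category_SymSet: "category (SymSet U)"
  unfolding category_def
proof (intro conjI ballI)
  fix x y f assume *: "x \<in> ob (SymSet U)" "y \<in> ob (SymSet U)" "f \<in> hom (SymSet U) x y"
  show "cmp (SymSet U) x x y f (idn (SymSet U) x) = f"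
    using * by (intro symset_hom_eqI[of _ x y]) (auto intro: cmp_symset_hom idn_symset_hom)
  show "cmp (SymSet U) x y y (idn (SymSet U) y) f = f"
    using * by (intro symset_hom_eqI[of _ x y])
      (auto intro: cmp_symset_hom idn_symset_hom simp: symset_hom_rules)
qed (auto simp: SymSet_cmp_eq_iff symset_hom_rules idn_symset_hom cmp_symset_hom)

section \<open>Symmetric sets inside a universe: codes, smallness and pullbacks\<close>

locale small_sets =
  fixes U :: "'u univ"
  assumes universe: "set_universe U"
begin

abbreviation nu :: "nat \<Rightarrow> 'u" where "nu \<equiv> unum U"
abbreviation pr :: "'u \<Rightarrow> 'u \<Rightarrow> 'u" where "pr x y \<equiv> upair U (x, y)"

lemma coding [simp]:
  "upair U p = upair U q \<longleftrightarrow> p = q" "nu m = nu n \<longleftrightarrow> m = n"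
  "ufst U (upair U p) = fst p" "usnd U (upair U p) = snd p" "unat U (nu n) = n"
  using universe by (auto simp: set_universe_def ufst_def usnd_def unat_def inj_eq)

lemma small_finite: "finite X \<Longrightarrow> usmall U X"
  and small_subset: "usmall U X \<Longrightarrow> Y \<subseteq> X \<Longrightarrow> usmall U Y"
  and small_product: "usmall U X \<Longrightarrow> usmall U Y \<Longrightarrow> usmall U (upair U ` (X \<times> Y))"
  using universe unfolding set_universe_def by blast+

text \<open>The forward direction tests the universal property against the symmetric set of matching
  pairs.\<close>

lemma pullback_SymSet_iff:
  assumes obs: "T \<in> ob (SymSet U)" "X \<in> ob (SymSet U)" "Y \<in> ob (SymSet U)"
    and a: "a \<in> symset_hom T X" and b: "b \<in> symset_hom T Y"
    and f: "f \<in> symset_hom X Z" and g: "g \<in> symset_hom Y Z"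
  shows "pullback_square (SymSet U) T X Y Z a b f g \<longleftrightarrow>
    (\<forall>n. \<forall>p\<in>elts T n. f n (a n p) = g n (b n p)) \<and>
    (\<forall>n. \<forall>x\<in>elts X n. \<forall>y\<in>elts Y n. f n x = g n y \<longrightarrow> (\<exists>!p. p \<in> elts T n \<and> a n p = x \<and> b n p = y))"
    (is "_ \<longleftrightarrow> ?comm \<and> ?ex")
proof (intro iffI conjI)
  assume pb: "pullback_square (SymSet U) T X Y Z a b f g"
  then show comm: ?comm by (simp add: pullback_square_def SymSet_cmp_eq_iff)
  define E where "E n = {pr x y | x y. x \<in> elts X n \<and> y \<in> elts Y n \<and> f n x = g n y}" for n
  define W where "W = \<lparr> elts = E, act = (\<lambda>n. \<lambda>z\<in>E n. \<lambda>\<sigma>\<in>Sym n.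
      pr (act X n (ufst U z) \<sigma>) (act Y n (usnd U z) \<sigma>)) \<rparr>"
  define c where "c n = (\<lambda>z\<in>E n. ufst U z)" for n
  define d where "d n = (\<lambda>z\<in>E n. usnd U z)" for n
  have EW: "elts W = E" by (simp add: W_def)
  have symW: "symmetric_set W"
    unfolding W_def using obs f g
    by (intro symmetric_setI) (auto simp: E_def symmetric_set_rules symset_hom_rules)
  have "usmall U (E n)" for n
    by (rule small_subset[OF small_product[of "elts X n" "elts Y n"]]) (use obs in \<open>auto simp: E_def\<close>)
  with symW have W: "W \<in> ob (SymSet U)" by (simp add: EW)
  have c: "c \<in> symset_hom W X" and d: "d \<in> symset_hom W Y"
    using obs f g by (auto simp: symset_hom_iff W_def c_def d_def E_def symmetric_set_rules)
  have "cmp (SymSet U) W X Z f c = cmp (SymSet U) W Y Z g d"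
    by (auto simp: SymSet_cmp_eq_iff EW c_def d_def E_def)
  then obtain h where h: "h \<in> symset_hom W T"
      and hc: "cmp (SymSet U) W T X a h = c" and hd: "cmp (SymSet U) W T Y b h = d"
    using pb W c d unfolding pullback_square_def by (metis SymSet_simps(2))
  \<comment> \<open>The cone from \<open>T\<close> itself gives a map \<open>k\<close> to the
    matching pairs. Both \<open>h\<close> after \<open>k\<close> and the identity mediate that cone,
    so they agree, and this makes \<open>p\<close> unique.\<close>
  define k where "k n = (\<lambda>p\<in>elts T n. pr (a n p) (b n p))" for n
  have k: "k \<in> symset_hom T W"
    using obs a b comm
    by (auto simp: symset_hom_iff k_def W_def E_def symmetric_set_rules)
  have hk: "cmp (SymSet U) T W T h k = idn (SymSet U) T" (is "?hk = _")
  proof -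
    have hk: "?hk \<in> symset_hom T T"
      using cmp_symset_hom[of T k W h T U] obs h k by simp
    have kE: "k n p \<in> E n" if "p \<in> elts T n" for n p
      using symset_hom_rules(1)[OF k that] by (simp add: EW)
    have "a n (h n z) = c n z" "b n (h n z) = d n z" if "z \<in> E n" for n z
      using fun_cong[OF fun_cong[OF hc, of n], of z] fun_cong[OF fun_cong[OF hd, of n], of z] that
      by (simp_all add: EW)
    then have "cmp (SymSet U) T T X a ?hk = a" "cmp (SymSet U) T T Y b ?hk = b"
      using a b obs hk kE
      by (auto intro!: symset_hom_eqI[OF cmp_symset_hom] simp: c_def d_def)
         (simp_all add: k_def)
    moreover have "cmp (SymSet U) T T X a (idn (SymSet U) T) = a"
        "cmp (SymSet U) T T Y b (idn (SymSet U) T) = b"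
      using category_rules(3)[OF category_SymSet, of T U] obs a b by simp_all
    moreover have "cmp (SymSet U) T X Z f a = cmp (SymSet U) T Y Z g b"
      using comm by (simp add: SymSet_cmp_eq_iff)
    ultimately show ?thesis
      using pb hk obs(1) a b idn_symset_hom[of T U] unfolding pullback_square_def
      by (metis SymSet_simps(1) SymSet_simps(2))
  qed
  show ?ex
  proof (intro allI ballI impI)
    fix n x y assume xy: "x \<in> elts X n" "y \<in> elts Y n" "f n x = g n y"
    then have z: "pr x y \<in> E n" by (auto simp: E_def)
    show "\<exists>!p. p \<in> elts T n \<and> a n p = x \<and> b n p = y"
    proof (rule ex1I[of _ "h n (pr x y)"])
      show "h n (pr x y) \<in> elts T n \<and> a n (h n (pr x y)) = x \<and> b n (h n (pr x y)) = y"
        using symset_hom_rules(1)[OF h, of "pr x y" n] z fun_cong[OF fun_cong[OF hc, of n], of "pr x y"]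
          fun_cong[OF fun_cong[OF hd, of n], of "pr x y"]
        by (simp add: EW c_def d_def)
      fix p assume p: "p \<in> elts T n \<and> a n p = x \<and> b n p = y"
      then show "p = h n (pr x y)"
        using fun_cong[OF fun_cong[OF hk, of n], of p] by (simp add: k_def)
    qed
  qed
next
  assume *: "?comm \<and> ?ex"
  have "\<exists>!h. h \<in> symset_hom W T \<and> cmp (SymSet U) W T X a h = c \<and> cmp (SymSet U) W T Y b h = d"
    if W: "W \<in> ob (SymSet U)" and c: "c \<in> symset_hom W X" and d: "d \<in> symset_hom W Y"
      and cd: "cmp (SymSet U) W X Z f c = cmp (SymSet U) W Y Z g d" for W c d
  proof -
    define h where "h n = (\<lambda>w\<in>elts W n. THE p. p \<in> elts T n \<and> a n p = c n w \<and> b n p = d n w)" for n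
    have ex1: "\<exists>!p. p \<in> elts T n \<and> a n p = c n w \<and> b n p = d n w" if w: "w \<in> elts W n" for n w
      using * w cd symset_hom_rules(1)[OF c w] symset_hom_rules(1)[OF d w]
      by (auto simp: SymSet_cmp_eq_iff)
    have h: "h n w \<in> elts T n" "a n (h n w) = c n w" "b n (h n w) = d n w" if "w \<in> elts W n" for n w
      using theI'[OF ex1[OF that]] that by (simp_all add: h_def)
    have hT: "h \<in> symset_hom W T"
      unfolding symset_hom_iff
    proof (intro conjI allI ballI)
      show "h n \<in> extensional (elts W n)" for n by (simp add: h_def)
      fix n w assume w: "w \<in> elts W n"
      then show "h n w \<in> elts T n" by (rule h)
      fix \<sigma> assume \<sigma>: "\<sigma> \<in> Sym n"
      have w': "act W n w \<sigma> \<in> elts W n" using W w \<sigma> by (simp add: symmetric_set_rules)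
      \<comment> \<open>Equivariance of the pointwise choice: the translate of \<open>h n w\<close>
        has the coordinates required of the value at the translate of \<open>w\<close>, and those
        determine an element.\<close>
      have "act T n (h n w) \<sigma> \<in> elts T n \<and> a n (act T n (h n w) \<sigma>) = c n (act W n w \<sigma>) \<and>
          b n (act T n (h n w) \<sigma>) = d n (act W n w \<sigma>)"
        using obs(1) a b c d w \<sigma> h[OF w] by (simp add: symmetric_set_rules symset_hom_rules)
      then show "h n (act W n w \<sigma>) = act T n (h n w) \<sigma>"
        using ex1[OF w'] h[OF w'] by blast
    qed
    show ?thesis
    proof (rule ex1I[of _ h])
      show "h \<in> symset_hom W T \<and> cmp (SymSet U) W T X a h = c \<and> cmp (SymSet U) W T Y b h = d"
        using W hT a b c d h
        by (auto intro!: symset_hom_eqI[OF cmp_symset_hom])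
      fix k assume k: "k \<in> symset_hom W T \<and> cmp (SymSet U) W T X a k = c \<and> cmp (SymSet U) W T Y b k = d"
      then have kT: "k \<in> symset_hom W T" by simp
      have "a n (k n w) = c n w" "b n (k n w) = d n w" if "w \<in> elts W n" for n w
        using k that by (metis SymSet_simps(4))+
      then show "k = h"
        using h ex1 symset_hom_rules(1)[OF kT] by (intro symset_hom_eqI[OF kT hT]) blast
    qed
  qed
  then show "pullback_square (SymSet U) T X Y Z a b f g"
    unfolding pullback_square_def using * a b f g by (simp add: SymSet_cmp_eq_iff)
qed

section \<open>Maps into \<delta>(Q) and the symmetric set of positions\<close>

lemma elts_delta: "z \<in> elts (delta U Q) n \<longleftrightarrow> usnd U z \<in> Q \<and> pr (nu n) (usnd U z) = z"
  by (auto simp: delta_def) metis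

lemma act_delta: "z \<in> elts (delta U Q) n \<Longrightarrow> \<sigma> \<in> Sym n \<Longrightarrow> act (delta U Q) n z \<sigma> = z"
  by (auto simp: delta_def)

text \<open>The action on \<delta>(Q) is trivial, so equivariance is invariance; the degree is part
  of the code, so a value is specified by its second component.\<close>

lemma symset_hom_delta_iff:
  "f \<in> symset_hom A (delta U Q) \<longleftrightarrow> (\<forall>n. f n \<in> extensional (elts A n) \<and>
     (\<forall>a\<in>elts A n. usnd U (f n a) \<in> Q \<and> pr (nu n) (usnd U (f n a)) = f n a \<and>
        (\<forall>\<sigma>\<in>Sym n. f n (act A n a \<sigma>) = f n a)))"
  unfolding symset_hom_iff by (auto simp: elts_delta act_delta)

lemma symset_hom_delta_rules:
  assumes "f \<in> symset_hom A (delta U Q)" "a \<in> elts A n"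
  shows "usnd U (f n a) \<in> Q" and "pr (nu n) (usnd U (f n a)) = f n a"
    and "\<sigma> \<in> Sym n \<Longrightarrow> f n (act A n a \<sigma>) = f n a"
  using assms unfolding symset_hom_delta_iff by auto

lemma delta_map_apply:
  assumes "f \<in> symset_hom A (delta U Q)" "a \<in> elts A n"
  shows "delta_map U Q u n (f n a) = pr (nu n) (u (usnd U (f n a)))"
  using symset_hom_rules(1)[OF assms] by (simp add: delta_map_def)

text \<open>Each degree of \<delta>(1) has a single element, so \<delta>(1) is terminal and
  \<open>to_delta_one\<close> is the map to it.\<close>

lemma symset_hom_delta_one_iff:
  assumes "symmetric_set A"
  shows "f \<in> symset_hom A (delta U (one U)) \<longleftrightarrow> f = to_delta_one U A"
proof -
  have "to_delta_one U A \<in> symset_hom A (delta U (one U))"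
    using assms by (auto simp: symset_hom_delta_iff to_delta_one_def one_def symmetric_set_rules)
  moreover have "f n a = pr (nu n) (nu 0)" if "f \<in> symset_hom A (delta U (one U))" "a \<in> elts A n" for f n a
    using symset_hom_delta_rules(1,2)[OF that] by (simp add: one_def)
  ultimately show ?thesis by (metis symset_hom_eqI)
qed

lemma elts_R: "z \<in> elts (R_set U) n \<longleftrightarrow> (\<exists>i\<in>{1..n}. z = pr (nu n) (nu i))"
  by (auto simp: R_set_def)

lemma act_R: "i \<in> {1..n} \<Longrightarrow> \<sigma> \<in> Sym n \<Longrightarrow>
    act (R_set U) n (pr (nu n) (nu i)) \<sigma> = pr (nu n) (nu (inv \<sigma> i))"
  by (auto simp: R_set_def)

text \<open>Inversion reverses composition, which turns the natural left action on positions into a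
  right action. Each degree is finite, hence small.\<close>

lemma R_ob: "R_set U \<in> ob (SymSet U)"
proof -
  have "symmetric_set (R_set U)"
    unfolding R_set_def
    by (rule symmetric_setI)
      (auto simp: inv_Sym_comp inv_Sym_image[unfolded atLeastAtMost_iff One_nat_def])
  moreover have "{pr (nu n) (nu i) |i. i \<in> {1..n}} = (\<lambda>i. pr (nu n) (nu i)) ` {1..n}" for n by auto
  ultimately show ?thesis by (simp add: R_set_def small_finite)
qed

section \<open>The fibration of symmetric signatures\<close>

lemma symset_hom_dagger_iff:
  assumes "symmetric_set A"
  shows "f \<in> symset_hom A (dagger Q) \<longleftrightarrow> (\<forall>n. f n \<in> extensional (elts A n) \<and>
     (\<forall>a\<in>elts A n. f n a \<in> {0..n} \<rightarrow>\<^sub>E Q \<and>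
        (\<forall>\<sigma>\<in>Sym n. f n (act A n a \<sigma>) = f n a \<circ> \<sigma>)))"
  unfolding symset_hom_iff by (auto simp: dagger_def)

lemma Sig_ob_rules:
  assumes "X \<in> ob (Sig_s U)"
  shows "symmetric_set (s_ops X)" and "usmall U (elts (s_ops X) n)" and "usmall U (s_sorts X)"
    and "s_typ X n \<in> extensional (elts (s_ops X) n)"
    and "a \<in> elts (s_ops X) n \<Longrightarrow> s_typ X n a \<in> {0..n} \<rightarrow>\<^sub>E s_sorts X"
    and "a \<in> elts (s_ops X) n \<Longrightarrow> i \<le> n \<Longrightarrow> s_typ X n a i \<in> s_sorts X"
    and "a \<in> elts (s_ops X) n \<Longrightarrow> \<sigma> \<in> Sym n \<Longrightarrow> s_typ X n (act (s_ops X) n a \<sigma>) = s_typ X n a \<circ> \<sigma>"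
proof -
  show sym: "symmetric_set (s_ops X)" and "usmall U (elts (s_ops X) n)" and "usmall U (s_sorts X)"
    using assms by (auto simp: Sig_s_def)
  have *: "s_typ X \<in> symset_hom (s_ops X) (dagger (s_sorts X))"
    using assms by (auto simp: Sig_s_def)
  then show "s_typ X n \<in> extensional (elts (s_ops X) n)"
    and "a \<in> elts (s_ops X) n \<Longrightarrow> \<sigma> \<in> Sym n \<Longrightarrow> s_typ X n (act (s_ops X) n a \<sigma>) = s_typ X n a \<circ> \<sigma>"
    by (auto simp: symset_hom_dagger_iff[OF sym])
  show **: "s_typ X n a \<in> {0..n} \<rightarrow>\<^sub>E s_sorts X" if "a \<in> elts (s_ops X) n" for a
    using * that by (auto simp: symset_hom_dagger_iff[OF sym])
  show "a \<in> elts (s_ops X) n \<Longrightarrow> i \<le> n \<Longrightarrow> s_typ X n a i \<in> s_sorts X"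
    using PiE_mem[OF **, of a i] by simp
qed

text \<open>Both typings are extensional on \<open>{0..n}\<close>, so the equation of functions in
  the definition may be tested index by index, with 0 included.\<close>

lemma Sig_hom_iff:
  assumes "X \<in> ob (Sig_s U)" "Y \<in> ob (Sig_s U)"
  shows "(f, u) \<in> hom (Sig_s U) X Y \<longleftrightarrow>
    f \<in> symset_hom (s_ops X) (s_ops Y) \<and> u \<in> s_sorts X \<rightarrow>\<^sub>E s_sorts Y \<and>
    (\<forall>n. \<forall>a\<in>elts (s_ops X) n. \<forall>i\<le>n. s_typ Y n (f n a) i = u (s_typ X n a i))"
proof -
  have "s_typ Y n (f n a) = compose {0..n} u (s_typ X n a) \<longleftrightarrow>
      (\<forall>i\<le>n. s_typ Y n (f n a) i = u (s_typ X n a i))"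
    if "f \<in> symset_hom (s_ops X) (s_ops Y)" "a \<in> elts (s_ops X) n" for n a
  proof -
    have "s_typ Y n (f n a) \<in> extensional {0..n}"
      using Sig_ob_rules(5)[OF assms(2) symset_hom_rules(1)[OF that]] by (simp add: PiE_iff)
    then show ?thesis
      by (auto simp: compose_def intro!: extensionalityI[of _ "{0..n}"])
  qed
  then show ?thesis by (auto simp: Sig_s_def)
qed

lemma Sig_simps:
  "idn (Sig_s U) X = (idn (SymSet U) (s_ops X), idn (SetC U) (s_sorts X))"
  "cmp (Sig_s U) X Y Z (g, v) (f, u) =
     (cmp (SymSet U) (s_ops X) (s_ops Y) (s_ops Z) g f, cmp (SetC U) (s_sorts X) (s_sorts Y) (s_sorts Z) v u)"
  by (simp_all add: Sig_s_def)

lemma Sig_homD: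
  "(f, u) \<in> hom (Sig_s U) X Y \<Longrightarrow> f \<in> hom (SymSet U) (s_ops X) (s_ops Y)"
  "(f, u) \<in> hom (Sig_s U) X Y \<Longrightarrow> u \<in> hom (SetC U) (s_sorts X) (s_sorts Y)"
  by (simp_all add: Sig_s_def)

lemma Sig_obD:
  "X \<in> ob (Sig_s U) \<Longrightarrow> s_ops X \<in> ob (SymSet U)"
  "X \<in> ob (Sig_s U) \<Longrightarrow> s_sorts X \<in> ob (SetC U)"
  by (simp_all add: Sig_s_def)

lemma category_Sig: "category (Sig_s U)"
  unfolding category_def
proof (intro conjI ballI)
  fix X assume X: "X \<in> ob (Sig_s U)"
  show "idn (Sig_s U) X \<in> hom (Sig_s U) X X"
    using X by (auto simp: Sig_simps Sig_hom_iff idn_symset_hom Sig_ob_rules)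
next
  fix X Y Z f g
  assume *: "X \<in> ob (Sig_s U)" "Y \<in> ob (Sig_s U)" "Z \<in> ob (Sig_s U)"
    "f \<in> hom (Sig_s U) X Y" "g \<in> hom (Sig_s U) Y Z"
  obtain f1 f2 g1 g2 where fg: "f = (f1, f2)" "g = (g1, g2)" by (cases f, cases g)
  have "cmp (SymSet U) (s_ops X) (s_ops Y) (s_ops Z) g1 f1 \<in> symset_hom (s_ops X) (s_ops Z)"
    using * Sig_obD Sig_homD unfolding fg by (intro cmp_symset_hom) auto
  then show "cmp (Sig_s U) X Y Z g f \<in> hom (Sig_s U) X Z"
    using * unfolding fg by (auto simp: Sig_simps Sig_hom_iff symset_hom_rules Sig_ob_rules)
next
  fix X Y f
  assume *: "X \<in> ob (Sig_s U)" "Y \<in> ob (Sig_s U)" "f \<in> hom (Sig_s U) X Y"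
  obtain f1 f2 where f: "f = (f1, f2)" by (cases f)
  show "cmp (Sig_s U) X X Y f (idn (Sig_s U) X) = f"
    using category_rules(3)[OF category_SymSet Sig_obD(1)[OF *(1)] Sig_obD(1)[OF *(2)] Sig_homD(1)[OF *(3)[unfolded f]]]
      category_rules(3)[OF category_SetC Sig_obD(2)[OF *(1)] Sig_obD(2)[OF *(2)] Sig_homD(2)[OF *(3)[unfolded f]]]
    by (simp add: f Sig_simps)
  show "cmp (Sig_s U) X Y Y (idn (Sig_s U) Y) f = f"
    using category_rules(4)[OF category_SymSet Sig_obD(1)[OF *(1)] Sig_obD(1)[OF *(2)] Sig_homD(1)[OF *(3)[unfolded f]]]
      category_rules(4)[OF category_SetC Sig_obD(2)[OF *(1)] Sig_obD(2)[OF *(2)] Sig_homD(2)[OF *(3)[unfolded f]]]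
    by (simp add: f Sig_simps)
next
  fix W X Y Z f g h
  assume *: "W \<in> ob (Sig_s U)" "X \<in> ob (Sig_s U)" "Y \<in> ob (Sig_s U)" "Z \<in> ob (Sig_s U)"
    "f \<in> hom (Sig_s U) W X" "g \<in> hom (Sig_s U) X Y" "h \<in> hom (Sig_s U) Y Z"
  obtain f1 f2 g1 g2 h1 h2 where fgh: "f = (f1, f2)" "g = (g1, g2)" "h = (h1, h2)"
    by (cases f, cases g, cases h)
  note H = *(5-7)[unfolded fgh]
  show "cmp (Sig_s U) W Y Z h (cmp (Sig_s U) W X Y g f) = cmp (Sig_s U) W X Z (cmp (Sig_s U) X Y Z h g) f"
    using category_rules(5)[OF category_SymSet Sig_obD(1)[OF *(1)] Sig_obD(1)[OF *(2)] Sig_obD(1)[OF *(3)]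
        Sig_obD(1)[OF *(4)] Sig_homD(1)[OF H(1)] Sig_homD(1)[OF H(2)] Sig_homD(1)[OF H(3)]]
      category_rules(5)[OF category_SetC Sig_obD(2)[OF *(1)] Sig_obD(2)[OF *(2)] Sig_obD(2)[OF *(3)]
        Sig_obD(2)[OF *(4)] Sig_homD(2)[OF H(1)] Sig_homD(2)[OF H(2)] Sig_homD(2)[OF H(3)]]
    by (simp add: fgh Sig_simps)
qed

lemma p_s_simps: "fob p_s X = s_sorts X" "far p_s X Y (f, u) = u"
  by (simp_all add: p_s_def)

lemma functor_p_s: "is_functor (Sig_s U) (SetC U) p_s"
  unfolding is_functor_def
proof (intro conjI ballI)
  fix X Y f assume "f \<in> hom (Sig_s U) X Y"
  then show "far p_s X Y f \<in> hom (SetC U) (fob p_s X) (fob p_s Y)"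
    by (cases f) (simp add: p_s_simps Sig_homD del: SetC_simps)
next
  fix X Y Z f g
  show "far p_s X Z (cmp (Sig_s U) X Y Z g f) =
     cmp (SetC U) (fob p_s X) (fob p_s Y) (fob p_s Z) (far p_s Y Z g) (far p_s X Y f)"
    by (cases f; cases g) (simp add: p_s_simps Sig_simps)
qed (auto simp: category_Sig category_SetC p_s_simps Sig_simps Sig_ob_rules)

section \<open>Coded tuples and reindexing of signatures\<close>

primrec tuple :: "nat \<Rightarrow> (nat \<Rightarrow> 'u) \<Rightarrow> 'u" where
  "tuple 0 d = d 0"
| "tuple (Suc n) d = pr (tuple n d) (d (Suc n))"

lemma tuple_inject: "tuple n d = tuple n d' \<Longrightarrow> i \<le> n \<Longrightarrow> d i = d' i"
  by (induction n) (auto simp: le_Suc_eq)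

lemma tuple_cong: "(\<And>i. i \<le> n \<Longrightarrow> d i = d' i) \<Longrightarrow> tuple n d = tuple n d'"
  by (induction n) auto

text \<open>Splitting off the last entry embeds the coded tuples into a coded product. The index set
  \<open>{0..n}\<close> gives \<open>n + 1\<close> entries, hence the single entry
  \<open>d 0\<close> at the base.\<close>

lemma small_tuples: "usmall U b \<Longrightarrow> usmall U (tuple n ` ({0..n} \<rightarrow>\<^sub>E b))"
proof (induction n)
  case 0
  then show ?case by (rule small_subset) auto
next
  case (Suc n)
  have "tuple (Suc n) ` ({0..Suc n} \<rightarrow>\<^sub>E b) \<subseteq> upair U ` (tuple n ` ({0..n} \<rightarrow>\<^sub>E b) \<times> b)"
  proof
    fix z assume "z \<in> tuple (Suc n) ` ({0..Suc n} \<rightarrow>\<^sub>E b)"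
    then obtain d where d: "d \<in> {0..Suc n} \<rightarrow>\<^sub>E b" and z: "z = tuple (Suc n) d" by auto
    have "tuple n d = tuple n (restrict d {0..n})" by (rule tuple_cong) simp
    moreover have "restrict d {0..n} \<in> {0..n} \<rightarrow>\<^sub>E b" "d (Suc n) \<in> b" using d by (auto simp: PiE_iff)
    ultimately show "z \<in> upair U ` (tuple n ` ({0..n} \<rightarrow>\<^sub>E b) \<times> b)" by (auto simp: z)
  qed
  with small_product[OF Suc.IH[OF Suc.prems] Suc.prems] show ?case by (rule small_subset)
qed

text \<open>\<open>tuple n\<close> reads only the entries up to \<open>n\<close>, so decoding is
  unique among extensional functions on \<open>{0..n}\<close>.\<close>

definition untuple :: "'u set \<Rightarrow> nat \<Rightarrow> 'u \<Rightarrow> nat \<Rightarrow> 'u" where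
  "untuple b n = inv_into ({0..n} \<rightarrow>\<^sub>E b) (tuple n)"

lemma inj_tuple: "inj_on (tuple n) ({0..n} \<rightarrow>\<^sub>E b)"
  by (rule inj_onI, rule PiE_ext) (auto dest: tuple_inject)

lemma untuple_tuple: "d \<in> {0..n} \<rightarrow>\<^sub>E b \<Longrightarrow> untuple b n (tuple n d) = d"
  unfolding untuple_def by (rule inv_into_f_f[OF inj_tuple])

text \<open>The coded fibre product of the typing map of \<open>Y\<close> with composition by
  \<open>u\<close> on \<open>b\<close>-valued typings; in other words, the pullback of \<partial>
  along the dagger of \<open>u\<close>.\<close>

definition reindex_elts :: "'u sig \<Rightarrow> 'u set \<Rightarrow> ('u \<Rightarrow> 'u) \<Rightarrow> nat \<Rightarrow> 'u set" where
  "reindex_elts Y b u n = {pr a (tuple n d) | a d.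
     a \<in> elts (s_ops Y) n \<and> d \<in> {0..n} \<rightarrow>\<^sub>E b \<and> s_typ Y n a = compose {0..n} u d}"

definition reindex :: "'u sig \<Rightarrow> 'u set \<Rightarrow> ('u \<Rightarrow> 'u) \<Rightarrow> 'u sig" where
  "reindex Y b u = \<lparr>
     s_ops = \<lparr> elts = reindex_elts Y b u, act = (\<lambda>n. \<lambda>z\<in>reindex_elts Y b u n. \<lambda>\<sigma>\<in>Sym n.
       pr (act (s_ops Y) n (ufst U z) \<sigma>) (tuple n (untuple b n (usnd U z) \<circ> \<sigma>))) \<rparr>,
     s_typ = (\<lambda>n. \<lambda>z\<in>reindex_elts Y b u n. untuple b n (usnd U z)),
     s_sorts = b \<rparr>"

lemma comp_Sym_PiE: "d \<in> {0..n} \<rightarrow>\<^sub>E b \<Longrightarrow> \<sigma> \<in> Sym n \<Longrightarrow> d \<circ> \<sigma> \<in> {0..n} \<rightarrow>\<^sub>E b"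
  using Sym_rules(3)[of \<sigma> n] by (auto simp: PiE_iff extensional_def)

lemma reindex_ob:
  assumes Y: "Y \<in> ob (Sig_s U)" and b: "usmall U b"
  shows "reindex Y b u \<in> ob (Sig_s U)"
proof -
  have closed: "pr (act (s_ops Y) n a \<sigma>) (tuple n (d \<circ> \<sigma>)) \<in> reindex_elts Y b u n"
    if "a \<in> elts (s_ops Y) n" "d \<in> {0..n} \<rightarrow>\<^sub>E b" "s_typ Y n a = compose {0..n} u d" "\<sigma> \<in> Sym n" for n a d \<sigma>
  proof -
    \<comment> \<open>Postcomposition with \<open>u\<close> commutes with reindexing by \<sigma>,
      also at the default values, because \<sigma> maps the complement of \<open>{0..n}\<close> to
      itself.\<close>
    have "compose {0..n} u d \<circ> \<sigma> = compose {0..n} u (d \<circ> \<sigma>)"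
      using Sym_rules(3)[OF that(4)] by (auto simp: compose_def)
    then have "s_typ Y n (act (s_ops Y) n a \<sigma>) = compose {0..n} u (d \<circ> \<sigma>)"
      using that Sig_ob_rules(7)[OF Y] by simp
    then show ?thesis
      using that comp_Sym_PiE Sig_ob_rules(1)[OF Y] unfolding reindex_elts_def mem_Collect_eq
      by (intro exI[of _ "act (s_ops Y) n a \<sigma>"] exI[of _ "d \<circ> \<sigma>"]) (simp add: symmetric_set_rules)
  qed
  have sym: "symmetric_set (s_ops (reindex Y b u))"
    unfolding reindex_def sig.simps
  proof (rule symmetric_setI)
    fix n z assume "z \<in> reindex_elts Y b u n"
    then obtain a d where z: "z = pr a (tuple n d)" "a \<in> elts (s_ops Y) n" "d \<in> {0..n} \<rightarrow>\<^sub>E b"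
      "s_typ Y n a = compose {0..n} u d" by (auto simp: reindex_elts_def)
    show "pr (act (s_ops Y) n (ufst U z) id) (tuple n (untuple b n (usnd U z) \<circ> id)) = z"
      using z Sig_ob_rules(1)[OF Y] by (simp add: untuple_tuple symmetric_set_rules)
    fix \<sigma> assume \<sigma>: "\<sigma> \<in> Sym n"
    show "pr (act (s_ops Y) n (ufst U z) \<sigma>) (tuple n (untuple b n (usnd U z) \<circ> \<sigma>)) \<in> reindex_elts Y b u n"
      using closed[OF z(2-4) \<sigma>] z by (simp add: untuple_tuple)
    fix \<tau> assume \<tau>: "\<tau> \<in> Sym n"
    show "pr (act (s_ops Y) n (ufst U z) (\<sigma> \<circ> \<tau>)) (tuple n (untuple b n (usnd U z) \<circ> (\<sigma> \<circ> \<tau>))) =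
      pr (act (s_ops Y) n (ufst U (pr (act (s_ops Y) n (ufst U z) \<sigma>) (tuple n (untuple b n (usnd U z) \<circ> \<sigma>)))) \<tau>)
       (tuple n (untuple b n (usnd U (pr (act (s_ops Y) n (ufst U z) \<sigma>) (tuple n (untuple b n (usnd U z) \<circ> \<sigma>)))) \<circ> \<tau>))"
      using z \<sigma> \<tau> Sig_ob_rules(1)[OF Y] comp_Sym_PiE[OF z(3) \<sigma>]
      by (simp add: untuple_tuple symmetric_set_rules comp_assoc)
  qed
  have "usmall U (reindex_elts Y b u n)" for n
    by (rule small_subset[OF small_product[OF Sig_ob_rules(2)[OF Y] small_tuples[OF b]]])
      (auto simp: reindex_elts_def)
  moreover have "s_typ (reindex Y b u) \<in> symset_hom (s_ops (reindex Y b u)) (dagger b)"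
    unfolding symset_hom_dagger_iff[OF sym]
  proof (intro conjI allI ballI)
    fix n z assume "z \<in> elts (s_ops (reindex Y b u)) n"
    then obtain a d where z: "z = pr a (tuple n d)" "a \<in> elts (s_ops Y) n" "d \<in> {0..n} \<rightarrow>\<^sub>E b"
      "s_typ Y n a = compose {0..n} u d" by (auto simp: reindex_def reindex_elts_def)
    then have zin: "pr a (tuple n d) \<in> reindex_elts Y b u n" by (auto simp: reindex_elts_def)
    show "s_typ (reindex Y b u) n z \<in> {0..n} \<rightarrow>\<^sub>E b"
      using z zin by (simp add: reindex_def untuple_tuple)
    fix \<sigma> assume \<sigma>: "\<sigma> \<in> Sym n"
    show "s_typ (reindex Y b u) n (act (s_ops (reindex Y b u)) n z \<sigma>) = s_typ (reindex Y b u) n z \<circ> \<sigma>"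
      using z(1,3) zin closed[OF z(2-4) \<sigma>] \<sigma> comp_Sym_PiE[OF z(3) \<sigma>]
      by (simp add: reindex_def untuple_tuple)
  qed (simp add: reindex_def)
  ultimately show ?thesis using sym b by (simp add: Sig_s_def reindex_def)
qed

text \<open>The lift of \<open>u\<close> is the projection of \<open>reindex Y b u\<close> to
  \<open>Y\<close>. A factorization over \<open>w\<close> is forced: the projection fixes the first
  entry of each image, and compatibility with typings fixes the second as the typing pushed along
  \<open>w\<close>.\<close>

lemma fibration_p_s: "fibration (Sig_s U) (SetC U) p_s"
proof -
  have "\<exists>X\<in>ob (Sig_s U). fob p_s X = b \<and>
      (\<exists>f. cartesian (Sig_s U) (SetC U) p_s X Y f \<and> far p_s X Y f = u)"
    if Y: "Y \<in> ob (Sig_s U)" and "b \<in> ob (SetC U)" and "u \<in> hom (SetC U) b (fob p_s Y)" for Y b u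
  proof -
    have b: "usmall U b" and u: "u \<in> b \<rightarrow>\<^sub>E s_sorts Y" using that by (simp_all add: p_s_simps)
    let ?X = "reindex Y b u"
    note X = reindex_ob[OF Y b, of u]
    define f where "f n = (\<lambda>z\<in>reindex_elts Y b u n. ufst U z)" for n
    have eX: "elts (s_ops ?X) = reindex_elts Y b u" and sX: "s_sorts ?X = b"
      by (simp_all add: reindex_def)
    have aX: "act (s_ops ?X) n (pr a (tuple n d)) \<sigma> = pr (act (s_ops Y) n a \<sigma>) (tuple n (d \<circ> \<sigma>))"
      if "pr a (tuple n d) \<in> reindex_elts Y b u n" "d \<in> {0..n} \<rightarrow>\<^sub>E b" "\<sigma> \<in> Sym n" for n a d \<sigma>
      using that by (simp add: reindex_def untuple_tuple)
    have tX: "s_typ ?X n (pr a (tuple n d)) = d"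
      if "pr a (tuple n d) \<in> reindex_elts Y b u n" "d \<in> {0..n} \<rightarrow>\<^sub>E b" for n a d
      using that by (simp add: reindex_def untuple_tuple)
    have fhom: "f \<in> symset_hom (s_ops ?X) (s_ops Y)"
      unfolding symset_hom_iff eX
    proof (intro conjI allI ballI)
      fix n z assume z: "z \<in> reindex_elts Y b u n"
      then show "f n z \<in> elts (s_ops Y) n" by (auto simp: f_def reindex_elts_def)
      fix \<sigma> assume \<sigma>: "\<sigma> \<in> Sym n"
      then have "act (s_ops ?X) n z \<sigma> \<in> reindex_elts Y b u n"
        using symmetric_set_rules(1)[OF Sig_ob_rules(1)[OF X], of z n \<sigma>] z by (simp add: eX)
      then show "f n (act (s_ops ?X) n z \<sigma>) = act (s_ops Y) n (f n z) \<sigma>"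
        using z \<sigma> by (simp add: f_def) (simp add: reindex_def)
    qed (simp add: f_def)
    have fu: "(f, u) \<in> hom (Sig_s U) ?X Y"
      unfolding Sig_hom_iff[OF X Y] eX sX
    proof (intro conjI allI ballI impI)
      fix n z i assume z: "z \<in> reindex_elts Y b u n" and i: "i \<le> n"
      then obtain a d where "z = pr a (tuple n d)" "d \<in> {0..n} \<rightarrow>\<^sub>E b"
        "s_typ Y n a = compose {0..n} u d" by (auto simp: reindex_elts_def)
      then show "s_typ Y n (f n z) i = u (s_typ ?X n z i)"
        using z i tX by (simp add: f_def compose_def)
    qed (use fhom u in simp_all)
    have "\<exists>!h. h \<in> hom (Sig_s U) Z ?X \<and> far p_s Z ?X h = w \<and> cmp (Sig_s U) Z ?X Y (f, u) h = g"
      if Z: "Z \<in> ob (Sig_s U)" and g: "g \<in> hom (Sig_s U) Z Y" and w: "w \<in> s_sorts Z \<rightarrow>\<^sub>E b"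
        and eq: "cmp (SetC U) (s_sorts Z) b (s_sorts Y) u w = far p_s Z Y g" for Z g w
    proof -
      obtain g1 g2 where g12: "g = (g1, g2)" by (cases g)
      have g1: "g1 \<in> symset_hom (s_ops Z) (s_ops Y)" using g by (simp add: g12 Sig_hom_iff[OF Z Y])
      have g2: "s_typ Y n (g1 n a) i = u (w (s_typ Z n a i))"
        if "a \<in> elts (s_ops Z) n" "i \<le> n" for n a i
      proof -
        have "s_typ Y n (g1 n a) i = g2 (s_typ Z n a i)"
          using g that by (simp add: g12 Sig_hom_iff[OF Z Y])
        also have "g2 = cmp (SetC U) (s_sorts Z) b (s_sorts Y) u w"
          using eq by (simp add: g12 p_s_simps)
        finally show "s_typ Y n (g1 n a) i = u (w (s_typ Z n a i))"
          using Sig_ob_rules(6)[OF Z that] by simp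
      qed
      let ?d = "\<lambda>n a. compose {0..n} w (s_typ Z n a)"
      define h where "h n = (\<lambda>a\<in>elts (s_ops Z) n. pr (g1 n a) (tuple n (?d n a)))" for n
      have d: "?d n a \<in> {0..n} \<rightarrow>\<^sub>E b" if "a \<in> elts (s_ops Z) n" for n a
        using w Sig_ob_rules(6)[OF Z that] by (auto simp: compose_def)
      have hin: "h n a \<in> reindex_elts Y b u n" if a: "a \<in> elts (s_ops Z) n" for n a
      proof -
        have "s_typ Y n (g1 n a) \<in> extensional {0..n}"
          using Sig_ob_rules(5)[OF Y symset_hom_rules(1)[OF g1 a]] by (simp add: PiE_iff)
        \<comment> \<open>The pair belongs to the fibre product because \<open>g\<close> lies over
          \<open>u\<close> after \<open>w\<close>.\<close>
        then have "s_typ Y n (g1 n a) = compose {0..n} u (?d n a)"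
          using g2[OF a] by (intro extensionalityI[of _ "{0..n}"]) (auto simp: compose_def)
        then show ?thesis
          using a d[OF a] symset_hom_rules(1)[OF g1 a] by (auto simp: h_def reindex_elts_def)
      qed
      have hhom: "h \<in> symset_hom (s_ops Z) (s_ops ?X)"
        unfolding symset_hom_iff eX
      proof (intro conjI allI ballI)
        fix n a assume a: "a \<in> elts (s_ops Z) n"
        show "h n a \<in> reindex_elts Y b u n" by (rule hin[OF a])
        fix \<sigma> assume \<sigma>: "\<sigma> \<in> Sym n"
        have a': "act (s_ops Z) n a \<sigma> \<in> elts (s_ops Z) n"
          using a \<sigma> Sig_ob_rules(1)[OF Z] by (simp add: symmetric_set_rules)
        have "tuple n (?d n (act (s_ops Z) n a \<sigma>)) = tuple n (?d n a \<circ> \<sigma>)"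
          using Sig_ob_rules(7)[OF Z a \<sigma>] Sym_rules(3)[OF \<sigma>] by (intro tuple_cong) (simp add: compose_def)
        then show "h n (act (s_ops Z) n a \<sigma>) = act (s_ops ?X) n (h n a) \<sigma>"
          using a a' aX[OF _ d[OF a] \<sigma>] hin[OF a] symset_hom_rules(2)[OF g1 a \<sigma>] by (simp add: h_def)
      qed (simp add: h_def)
      show ?thesis
      proof (rule ex1I[of _ "(h, w)"], intro conjI)
        show "(h, w) \<in> hom (Sig_s U) Z ?X"
          unfolding Sig_hom_iff[OF Z X]
        proof (intro conjI allI ballI impI)
          fix n a i assume a: "a \<in> elts (s_ops Z) n" and i: "i \<le> n"
          show "s_typ ?X n (h n a) i = w (s_typ Z n a i)"
            using tX[of "g1 n a" n "?d n a"] hin[OF a] d[OF a] a i by (simp add: h_def compose_def)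
        qed (use hhom w sX in simp_all)
        show "far p_s Z ?X (h, w) = w" by (simp add: p_s_simps)
        have "cmp (SymSet U) (s_ops Z) (s_ops ?X) (s_ops Y) f h = g1"
          using hin by (intro symset_hom_eqI[OF cmp_symset_hom[OF Sig_ob_rules(1)[OF Z] hhom fhom] g1])
             (auto simp: f_def, simp add: h_def)
        then show "cmp (Sig_s U) Z ?X Y (f, u) (h, w) = g"
          using eq by (simp add: Sig_simps sX g12 p_s_simps)
      next
        fix k assume k: "k \<in> hom (Sig_s U) Z ?X \<and> far p_s Z ?X k = w \<and> cmp (Sig_s U) Z ?X Y (f, u) k = g"
        then obtain k1 where k1: "k = (k1, w)" by (cases k) (auto simp: p_s_simps)
        have k1hom: "k1 \<in> symset_hom (s_ops Z) (s_ops ?X)"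
          and k1typ: "\<And>n a i. a \<in> elts (s_ops Z) n \<Longrightarrow> i \<le> n \<Longrightarrow> s_typ ?X n (k1 n a) i = w (s_typ Z n a i)"
          using k by (auto simp: k1 Sig_hom_iff[OF Z X])
        have "k1 n a = h n a" if a: "a \<in> elts (s_ops Z) n" for n a
        proof -
          have "k1 n a \<in> reindex_elts Y b u n"
            using symset_hom_rules(1)[OF k1hom a] by (simp add: eX)
          then obtain c d' where c: "k1 n a = pr c (tuple n d')" "d' \<in> {0..n} \<rightarrow>\<^sub>E b"
              "pr c (tuple n d') \<in> reindex_elts Y b u n"
            by (auto simp: reindex_elts_def)
          have "f n (k1 n a) = g1 n a"
            using k a by (auto simp: k1 Sig_simps g12)
          then have "c = g1 n a" using c by (simp add: f_def)
          moreover have "tuple n d' = tuple n (?d n a)"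
            using k1typ[OF a] tX[OF c(3,2)] by (intro tuple_cong) (simp add: c(1) compose_def)
          ultimately show ?thesis using a c(1) by (simp add: h_def)
        qed
        then show "k = (h, w)" using symset_hom_eqI[OF k1hom hhom] by (simp add: k1)
      qed
    qed
    then have "cartesian (Sig_s U) (SetC U) p_s ?X Y (f, u)"
      unfolding cartesian_def using fu by (simp add: p_s_simps sX)
    then show ?thesis using X by (intro bexI[of _ ?X] conjI exI[of _ "(f, u)"]) (simp_all add: p_s_simps sX)
  qed
  then show ?thesis unfolding fibration_def using functor_p_s by blast
qed

section \<open>Analytic diagrams\<close>

lemma PsAnDiag_ob_iff:
  "D \<in> ob (PsAnDiag U) \<longleftrightarrow> usmall U (d_sorts D) \<and> d_E D \<in> ob (SymSet U) \<and> d_A D \<in> ob (SymSet U) \<and>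
     d_s D \<in> symset_hom (d_E D) (delta U (d_sorts D)) \<and> d_p D \<in> symset_hom (d_E D) (d_A D) \<and>
     d_t D \<in> symset_hom (d_A D) (delta U (d_sorts D)) \<and>
     (\<forall>n. \<forall>a\<in>elts (d_A D) n. finite {e \<in> elts (d_E D) n. d_p D n e = a})"
  by (simp add: PsAnDiag_def)

text \<open>Values in \<delta> are compared by second components, and the universal property becomes
  a bijection between the fibres of \<open>d_p X\<close> and \<open>d_p Y\<close> over corresponding
  operations.\<close>

lemma PsAnDiag_hom_iff:
  assumes "X \<in> ob (PsAnDiag U)" "Y \<in> ob (PsAnDiag U)"
  shows "(f, g, u) \<in> hom (PsAnDiag U) X Y \<longleftrightarrow>
    f \<in> symset_hom (d_A X) (d_A Y) \<and> g \<in> symset_hom (d_E X) (d_E Y) \<and> u \<in> d_sorts X \<rightarrow>\<^sub>E d_sorts Y \<and>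
    (\<forall>n. \<forall>e\<in>elts (d_E X) n. d_s Y n (g n e) = pr (nu n) (u (usnd U (d_s X n e)))) \<and>
    (\<forall>n. \<forall>a\<in>elts (d_A X) n. d_t Y n (f n a) = pr (nu n) (u (usnd U (d_t X n a)))) \<and>
    (\<forall>n. \<forall>e\<in>elts (d_E X) n. d_p Y n (g n e) = f n (d_p X n e)) \<and>
    (\<forall>n. \<forall>e'\<in>elts (d_E Y) n. \<forall>a\<in>elts (d_A X) n. d_p Y n e' = f n a \<longrightarrow>
       (\<exists>!e. e \<in> elts (d_E X) n \<and> g n e = e' \<and> d_p X n e = a))"
proof -
  have pb: "pullback_square (SymSet U) (d_E X) (d_E Y) (d_A X) (d_A Y) g (d_p X) (d_p Y) f \<longleftrightarrow>
    (\<forall>n. \<forall>e\<in>elts (d_E X) n. d_p Y n (g n e) = f n (d_p X n e)) \<and>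
    (\<forall>n. \<forall>e'\<in>elts (d_E Y) n. \<forall>a\<in>elts (d_A X) n. d_p Y n e' = f n a \<longrightarrow>
       (\<exists>!e. e \<in> elts (d_E X) n \<and> g n e = e' \<and> d_p X n e = a))"
    if "f \<in> symset_hom (d_A X) (d_A Y)" "g \<in> symset_hom (d_E X) (d_E Y)"
    using assms that by (intro pullback_SymSet_iff) (auto simp: PsAnDiag_ob_iff)
  have s: "delta_map U (d_sorts X) u n (d_s X n e) = pr (nu n) (u (usnd U (d_s X n e)))"
    if "e \<in> elts (d_E X) n" for n e
    using assms that by (intro delta_map_apply[of _ "d_E X"]) (auto simp: PsAnDiag_ob_iff)
  have t: "delta_map U (d_sorts X) u n (d_t X n a) = pr (nu n) (u (usnd U (d_t X n a)))"
    if "a \<in> elts (d_A X) n" for n a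
    using assms that by (intro delta_map_apply[of _ "d_A X"]) (auto simp: PsAnDiag_ob_iff)
  show ?thesis
  \<comment> \<open>The pointwise form of the pullback condition presupposes that \<open>f\<close>
    and \<open>g\<close> are equivariant; when they are not, both sides are false.\<close>
  proof (cases "f \<in> symset_hom (d_A X) (d_A Y) \<and> g \<in> symset_hom (d_E X) (d_E Y)")
    case True
    then show ?thesis
      using pb by (simp add: PsAnDiag_def SymSet_cmp_eq_iff s t)
  next
    case False
    then show ?thesis by (auto simp: PsAnDiag_def)
  qed
qed

lemma delta_one_ob: "delta U (one U) \<in> ob (SymSet U)"
proof -
  have "symmetric_set (delta U (one U))"
    unfolding delta_def by (rule symmetric_setI) simp_all
  moreover have "elts (delta U (one U)) n = {pr (nu n) (nu 0)}" for n
    by (auto simp: delta_def one_def)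
  ultimately show ?thesis by (simp add: small_finite)
qed

lemma R_diag_ob: "R_diag U \<in> ob (PsAnDiag U)"
proof -
  have "finite {e \<in> elts (R_set U) n. P e}" for n P
  proof (rule finite_subset)
    show "{e \<in> elts (R_set U) n. P e} \<subseteq> (\<lambda>i. pr (nu n) (nu i)) ` {1..n}" by (auto simp: elts_R)
  qed simp
  moreover have "to_delta_one U A \<in> symset_hom A (delta U (one U))" if "A \<in> ob (SymSet U)" for A
    using that symset_hom_delta_one_iff by simp
  ultimately show ?thesis
    using R_ob delta_one_ob unfolding PsAnDiag_ob_iff
    by (simp add: R_diag_def one_def small_finite del: SymSet_simps)
qed

lemma ball_R: "(\<forall>z\<in>elts (R_set U) n. Q z) \<longleftrightarrow> (\<forall>i\<in>{1..n}. Q (pr (nu n) (nu i)))"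
  by (auto simp: elts_R)

text \<open>Terminality of \<delta>(1) and of the one-element set fixes two components of the
  structure map and makes the squares for \<open>s\<close> and \<open>t\<close> commute. The
  pullback over \<open>R_set U\<close> then says that \<open>E\<close> is, degree by degree, the
  product of \<open>A\<close> with the positions.\<close>

lemma AnDiag_ob_iff:
  "(D, h) \<in> ob (AnDiag U) \<longleftrightarrow> D \<in> ob (PsAnDiag U) \<and>
     fst h = to_delta_one U (d_A D) \<and> snd (snd h) = (\<lambda>x\<in>d_sorts D. nu 0) \<and>
     fst (snd h) \<in> symset_hom (d_E D) (R_set U) \<and>
     (\<forall>n. \<forall>i\<in>{1..n}. \<forall>a\<in>elts (d_A D) n.
        \<exists>!e. e \<in> elts (d_E D) n \<and> fst (snd h) n e = pr (nu n) (nu i) \<and> d_p D n e = a)"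
proof -
  obtain f r u where h: "h = (f, r, u)" by (cases h)
  have "(f, r, u) \<in> hom (PsAnDiag U) D (R_diag U) \<longleftrightarrow> 
     f = to_delta_one U (d_A D) \<and> u = (\<lambda>x\<in>d_sorts D. nu 0) \<and> r \<in> symset_hom (d_E D) (R_set U) \<and>
     (\<forall>n. \<forall>i\<in>{1..n}. \<forall>a\<in>elts (d_A D) n.
        \<exists>!e. e \<in> elts (d_E D) n \<and> r n e = pr (nu n) (nu i) \<and> d_p D n e = a)" (is "?hom \<longleftrightarrow> ?R")
    if D: "D \<in> ob (PsAnDiag U)"
  proof -
    have symA: "symmetric_set (d_A D)" using D by (simp add: PsAnDiag_ob_iff)
    have u: "u \<in> d_sorts D \<rightarrow>\<^sub>E one U \<longleftrightarrow> u = (\<lambda>x\<in>d_sorts D. nu 0)"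
      by (auto simp: one_def PiE_iff intro!: extensionalityI[of _ "d_sorts D"])
    show ?thesis
    proof (cases "f = to_delta_one U (d_A D) \<and> u = (\<lambda>x\<in>d_sorts D. nu 0) \<and> r \<in> symset_hom (d_E D) (R_set U)")
      case True
      have p: "d_p D n e \<in> elts (d_A D) n" and s: "usnd U (d_s D n e) \<in> d_sorts D" if "e \<in> elts (d_E D) n" for n e
        using D that by (auto simp: PsAnDiag_ob_iff dest: symset_hom_delta_rules symset_hom_rules)
      have t: "usnd U (d_t D n a) \<in> d_sorts D" if "a \<in> elts (d_A D) n" for n a
        using D that by (auto simp: PsAnDiag_ob_iff dest: symset_hom_delta_rules symset_hom_rules)
      have one: "pr (nu n) (nu 0) \<in> elts (delta U (one U)) n" for n
        by (simp add: elts_delta one_def)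
      have R: "r n e \<in> elts (R_set U) n" if "e \<in> elts (d_E D) n" for n e
        using True that by (blast dest: symset_hom_rules(1))
      show ?thesis
        unfolding PsAnDiag_hom_iff[OF D R_diag_ob]
        using True u symset_hom_delta_one_iff[OF symA, of f]
        by (simp add: R_diag_def to_delta_one_def p s t one R ball_R)
    next
      case False
      then show ?thesis
        unfolding PsAnDiag_hom_iff[OF D R_diag_ob]
        using u symset_hom_delta_one_iff[OF symA, of f] by (auto simp: R_diag_def)
    qed
  qed
  moreover have "(D, h) \<in> ob (AnDiag U) \<longleftrightarrow> D \<in> ob (PsAnDiag U) \<and> (f, r, u) \<in> hom (PsAnDiag U) D (R_diag U)"
    by (simp add: AnDiag_def slice_def h)
  ultimately show ?thesis unfolding h fst_conv snd_conv by blast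
qed

section \<open>Elements of E as operations with a position\<close>

definition pos :: "'u diag_map \<Rightarrow> nat \<Rightarrow> 'u \<Rightarrow> nat" where
  "pos h n e = unat U (usnd U (fst (snd h) n e))"

text \<open>The inverse of the map taking an element \<open>e\<close> to \<open>d_p D n e\<close>
  and \<open>pos h n e\<close>.\<close>

definition elem :: "'u diag \<Rightarrow> 'u diag_map \<Rightarrow> nat \<Rightarrow> 'u \<Rightarrow> nat \<Rightarrow> 'u" where
  "elem D h n a i = (THE e. e \<in> elts (d_E D) n \<and> fst (snd h) n e = pr (nu n) (nu i) \<and> d_p D n e = a)"

lemma AnDiag_ob_rules:
  assumes "(D, h) \<in> ob (AnDiag U)"
  shows "D \<in> ob (PsAnDiag U)" and "usmall U (d_sorts D)"
    and "symmetric_set (d_A D)" and "usmall U (elts (d_A D) n)" and "symmetric_set (d_E D)"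
    and "d_A D \<in> ob (SymSet U)" and "d_E D \<in> ob (SymSet U)" and "d_sorts D \<in> ob (SetC U)"
    and "d_p D \<in> symset_hom (d_E D) (d_A D)"
    and "d_s D \<in> symset_hom (d_E D) (delta U (d_sorts D))"
    and "d_t D \<in> symset_hom (d_A D) (delta U (d_sorts D))"
    and "fst h = to_delta_one U (d_A D)" and "snd (snd h) = (\<lambda>x\<in>d_sorts D. nu 0)"
    and "fst (snd h) \<in> symset_hom (d_E D) (R_set U)"
  using assms unfolding AnDiag_ob_iff PsAnDiag_ob_iff by simp_all

lemma pos_rules:
  assumes X: "(D, h) \<in> ob (AnDiag U)" and e: "e \<in> elts (d_E D) n"
  shows "pos h n e \<in> {1..n}" and "fst (snd h) n e = pr (nu n) (nu (pos h n e))"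
    and "\<sigma> \<in> Sym n \<Longrightarrow> pos h n (act (d_E D) n e \<sigma>) = inv \<sigma> (pos h n e)"
proof -
  note r = AnDiag_ob_rules(14)[OF X]
  obtain i where "i \<in> {1..n}" "fst (snd h) n e = pr (nu n) (nu i)"
    using symset_hom_rules(1)[OF r e] by (auto simp: elts_R)
  then show *: "pos h n e \<in> {1..n}" "fst (snd h) n e = pr (nu n) (nu (pos h n e))"
    by (simp_all add: pos_def)
  show "pos h n (act (d_E D) n e \<sigma>) = inv \<sigma> (pos h n e)" if \<sigma>: "\<sigma> \<in> Sym n"
    unfolding pos_def[of h n "act (d_E D) n e \<sigma>"] symset_hom_rules(2)[OF r e \<sigma>] *(2) act_R[OF *(1) \<sigma>]
    by simp
qed

lemma elem_rules:
  assumes X: "(D, h) \<in> ob (AnDiag U)" and a: "a \<in> elts (d_A D) n" and i: "i \<in> {1..n}"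
  shows "elem D h n a i \<in> elts (d_E D) n" and "d_p D n (elem D h n a i) = a"
    and "pos h n (elem D h n a i) = i"
proof -
  have "\<exists>!e. e \<in> elts (d_E D) n \<and> fst (snd h) n e = pr (nu n) (nu i) \<and> d_p D n e = a"
    using X a i unfolding AnDiag_ob_iff by blast
  from theI'[OF this] show "elem D h n a i \<in> elts (d_E D) n" "d_p D n (elem D h n a i) = a"
    "pos h n (elem D h n a i) = i" unfolding elem_def[symmetric] by (simp_all add: pos_def)
qed

lemma elem_unique:
  assumes X: "(D, h) \<in> ob (AnDiag U)" and e: "e \<in> elts (d_E D) n"
  shows "elem D h n (d_p D n e) (pos h n e) = e"
proof -
  have a: "d_p D n e \<in> elts (d_A D) n"
    by (rule symset_hom_rules(1)[OF AnDiag_ob_rules(9)[OF X] e])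
  note i = pos_rules(1)[OF X e]
  have "\<exists>!e'. e' \<in> elts (d_E D) n \<and> fst (snd h) n e' = pr (nu n) (nu (pos h n e)) \<and> d_p D n e' = d_p D n e"
    using X a i unfolding AnDiag_ob_iff by blast
  then show ?thesis
    using elem_rules[OF X a i] e pos_rules(2)[OF X e] pos_rules(2)[OF X elem_rules(1)[OF X a i]] by metis
qed

lemma elem_eqI:
  assumes "(D, h) \<in> ob (AnDiag U)" "e \<in> elts (d_E D) n" "d_p D n e = a" "pos h n e = i"
  shows "elem D h n a i = e"
  using elem_unique[OF assms(1,2)] assms(3,4) by simp

text \<open>Acting by \<sigma> moves position \<open>j\<close> to \<open>inv \<sigma> j\<close>, so
  the element that arrives at position \<open>i\<close> starts at \<open>\<sigma> i\<close>. This
  index later turns invariance of \<open>s\<close> into the rule that typings are composed with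
  \<sigma>.\<close>

lemma elem_act:
  assumes X: "(D, h) \<in> ob (AnDiag U)" and a: "a \<in> elts (d_A D) n" and i: "i \<in> {1..n}" and \<sigma>: "\<sigma> \<in> Sym n"
  shows "elem D h n (act (d_A D) n a \<sigma>) i = act (d_E D) n (elem D h n a (\<sigma> i)) \<sigma>"
proof -
  have \<sigma>i: "\<sigma> i \<in> {1..n}" using i Sym_rules(2)[OF \<sigma>] by blast
  note e = elem_rules[OF X a \<sigma>i]
  show ?thesis
    by (rule elem_eqI[OF X])
      (simp_all add: e \<sigma> symmetric_set_rules(1)[OF AnDiag_ob_rules(5)[OF X]] pos_rules(3)[OF X]
        symset_hom_rules(2)[OF AnDiag_ob_rules(9)[OF X]] Sym_rules(5)[OF \<sigma>])
qed

text \<open>The pullback condition is replaced by preservation of positions: both projections to the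
  operations are pulled back from \<open>R_set U\<close>, so a commuting square compatible with
  positions is itself a pullback. The triangles over \<delta>(1) and the one-element set commute by
  terminality.\<close>

lemma AnDiag_hom_iff:
  assumes X: "(D, h) \<in> ob (AnDiag U)" and Y: "(D', h') \<in> ob (AnDiag U)"
  shows "(f, g, u) \<in> hom (AnDiag U) (D, h) (D', h') \<longleftrightarrow>
    f \<in> symset_hom (d_A D) (d_A D') \<and> g \<in> symset_hom (d_E D) (d_E D') \<and> u \<in> d_sorts D \<rightarrow>\<^sub>E d_sorts D' \<and>
    (\<forall>n. \<forall>e\<in>elts (d_E D) n. d_s D' n (g n e) = pr (nu n) (u (usnd U (d_s D n e)))) \<and>
    (\<forall>n. \<forall>a\<in>elts (d_A D) n. d_t D' n (f n a) = pr (nu n) (u (usnd U (d_t D n a)))) \<and>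
    (\<forall>n. \<forall>e\<in>elts (d_E D) n. d_p D' n (g n e) = f n (d_p D n e)) \<and>
    (\<forall>n. \<forall>e\<in>elts (d_E D) n. pos h' n (g n e) = pos h n e)" (is "?L \<longleftrightarrow> ?R")
proof
  obtain r v w r' v' w' where h: "h = (v, r, w)" "h' = (v', r', w')" by (cases h, cases h')
  have L: "?L \<longleftrightarrow> (f, g, u) \<in> hom (PsAnDiag U) D D' \<and>
     cmp (SymSet U) (d_A D) (d_A D') (delta U (one U)) v' f = v \<and>
     cmp (SymSet U) (d_E D) (d_E D') (R_set U) r' g = r \<and>
     cmp (SetC U) (d_sorts D) (d_sorts D') (one U) w' u = w"
    by (simp add: AnDiag_def slice_def PsAnDiag_def h R_diag_def)
  {
    assume ?L
    then have hom: "(f, g, u) \<in> hom (PsAnDiag U) D D'" and eq: "cmp (SymSet U) (d_E D) (d_E D') (R_set U) r' g = r"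
      using L by blast+
    have "pos h' n (g n e) = pos h n e" if "e \<in> elts (d_E D) n" for n e
      using that unfolding pos_def h fst_conv snd_conv eq[symmetric] by simp
    then show ?R
      using hom unfolding PsAnDiag_hom_iff[OF AnDiag_ob_rules(1)[OF X] AnDiag_ob_rules(1)[OF Y]] by blast
  next
    assume R: ?R
    then have f: "f \<in> symset_hom (d_A D) (d_A D')" and g: "g \<in> symset_hom (d_E D) (d_E D')"
      and u: "u \<in> d_sorts D \<rightarrow>\<^sub>E d_sorts D'"
      and p: "\<And>n e. e \<in> elts (d_E D) n \<Longrightarrow> d_p D' n (g n e) = f n (d_p D n e)"
      and pos: "\<And>n e. e \<in> elts (d_E D) n \<Longrightarrow> pos h' n (g n e) = pos h n e" by blast+
    have "\<exists>!e. e \<in> elts (d_E D) n \<and> g n e = e' \<and> d_p D n e = a"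
      if e': "e' \<in> elts (d_E D') n" and a: "a \<in> elts (d_A D) n" and eq: "d_p D' n e' = f n a" for n e' a
    \<comment> \<open>A preimage of \<open>e'\<close> over \<open>a\<close> must have the position
      of \<open>e'\<close>, and operation and position leave one candidate.\<close>
    proof (rule ex1I[of _ "elem D h n a (pos h' n e')"], intro conjI)
      note i = pos_rules(1)[OF Y e']
      note e = elem_rules[OF X a i]
      show "elem D h n a (pos h' n e') \<in> elts (d_E D) n" "d_p D n (elem D h n a (pos h' n e')) = a"
        by (rule e)+
      show "g n (elem D h n a (pos h' n e')) = e'"
        using elem_unique[OF Y e'] elem_unique[OF Y symset_hom_rules(1)[OF g e(1)]] p[OF e(1)] pos[OF e(1)] e eq
        by simp
      fix k assume "k \<in> elts (d_E D) n \<and> g n k = e' \<and> d_p D n k = a"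
      then show "k = elem D h n a (pos h' n e')"
        using elem_unique[OF X, of k n] pos[of k n] by auto
    qed
    then have "(f, g, u) \<in> hom (PsAnDiag U) D D'"
      using R unfolding PsAnDiag_hom_iff[OF AnDiag_ob_rules(1)[OF X] AnDiag_ob_rules(1)[OF Y]] by blast
    moreover have "cmp (SymSet U) (d_A D) (d_A D') (delta U (one U)) v' f = v"
    proof -
      have "cmp (SymSet U) (d_A D) (d_A D') (delta U (one U)) v' f \<in> symset_hom (d_A D) (delta U (one U))"
        using AnDiag_ob_rules(3,12)[OF X] AnDiag_ob_rules(3,12)[OF Y] symset_hom_delta_one_iff f
        by (intro cmp_symset_hom) (auto simp: h)
      then show ?thesis using AnDiag_ob_rules(3,12)[OF X] symset_hom_delta_one_iff by (simp add: h)
    qed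
    moreover have "cmp (SymSet U) (d_E D) (d_E D') (R_set U) r' g = r"
    proof (rule symset_hom_eqI)
      show "r \<in> symset_hom (d_E D) (R_set U)" using AnDiag_ob_rules(14)[OF X] by (simp add: h)
      show "cmp (SymSet U) (d_E D) (d_E D') (R_set U) r' g \<in> symset_hom (d_E D) (R_set U)"
        using AnDiag_ob_rules(14)[OF Y] AnDiag_ob_rules(5)[OF X] g by (intro cmp_symset_hom) (auto simp: h)
      fix n e assume e: "e \<in> elts (d_E D) n"
      show "cmp (SymSet U) (d_E D) (d_E D') (R_set U) r' g n e = r n e"
        using pos_rules(2)[OF X e] pos_rules(2)[OF Y symset_hom_rules(1)[OF g e]] pos[OF e] e by (simp add: h)
    qed
    moreover have "cmp (SetC U) (d_sorts D) (d_sorts D') (one U) w' u = w"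
    proof
      show "cmp (SetC U) (d_sorts D) (d_sorts D') (one U) w' u x = w x" for x
        using AnDiag_ob_rules(13)[OF X] AnDiag_ob_rules(13)[OF Y] u
        by (cases "x \<in> d_sorts D") (auto simp: h)
    qed
    ultimately show ?L using L by blast
  }
qed

section \<open>The category of analytic diagrams and its projection\<close>

lemma AnDiag_simps:
  "idn (AnDiag U) (D, h) = (idn (SymSet U) (d_A D), idn (SymSet U) (d_E D), idn (SetC U) (d_sorts D))"
  "cmp (AnDiag U) (D, h) (D', h') (D'', h'') (f', g', u') (f, g, u) =
     (cmp (SymSet U) (d_A D) (d_A D') (d_A D'') f' f, cmp (SymSet U) (d_E D) (d_E D') (d_E D'') g' g,
      cmp (SetC U) (d_sorts D) (d_sorts D') (d_sorts D'') u' u)"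
  by (simp_all add: AnDiag_def slice_def PsAnDiag_def)

lemma AnDiag_homD:
  assumes "(D, h) \<in> ob (AnDiag U)" "(D', h') \<in> ob (AnDiag U)" "(f, g, u) \<in> hom (AnDiag U) (D, h) (D', h')"
  shows "f \<in> hom (SymSet U) (d_A D) (d_A D')" "g \<in> hom (SymSet U) (d_E D) (d_E D')"
    "u \<in> hom (SetC U) (d_sorts D) (d_sorts D')"
  using assms(3) by (auto simp: AnDiag_hom_iff[OF assms(1,2)])

text \<open>Closure under composition is verified in the pointwise description, where pullback
  squares have become maps preserving positions; the laws hold in each of the three components
  separately.\<close>

lemma category_AnDiag: "category (AnDiag U)"
  unfolding category_def
proof (intro conjI ballI)
  fix X assume X: "X \<in> ob (AnDiag U)"
  obtain D h where [simp]: "X = (D, h)" by (cases X)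
  show "idn (AnDiag U) X \<in> hom (AnDiag U) X X"
    using AnDiag_ob_rules[of D h] X
    by (auto simp: AnDiag_simps AnDiag_hom_iff idn_symset_hom symset_hom_delta_rules symset_hom_rules)
next
  fix X Y Z f g
  assume *: "X \<in> ob (AnDiag U)" "Y \<in> ob (AnDiag U)" "Z \<in> ob (AnDiag U)"
    "f \<in> hom (AnDiag U) X Y" "g \<in> hom (AnDiag U) Y Z"
  obtain D h D' h' D'' h'' f1 f2 f3 g1 g2 g3 where
    XYZ [simp]: "X = (D, h)" "Y = (D', h')" "Z = (D'', h'')" "f = (f1, f2, f3)" "g = (g1, g2, g3)"
    by (cases X, cases Y, cases Z, cases f, cases g)
  note O = *(1-3)[unfolded XYZ]
  have "cmp (SymSet U) (d_A D) (d_A D') (d_A D'') g1 f1 \<in> symset_hom (d_A D) (d_A D'')"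
      "cmp (SymSet U) (d_E D) (d_E D') (d_E D'') g2 f2 \<in> symset_hom (d_E D) (d_E D'')"
    using AnDiag_homD(1,2)[OF O(1,2) *(4)[unfolded XYZ]] AnDiag_homD(1,2)[OF O(2,3) *(5)[unfolded XYZ]]
      cmp_symset_hom[OF AnDiag_ob_rules(3)[OF O(1)]] cmp_symset_hom[OF AnDiag_ob_rules(5)[OF O(1)]] by simp_all
  moreover have "usnd U (d_s D n e) \<in> d_sorts D" "d_p D n e \<in> elts (d_A D) n" if "e \<in> elts (d_E D) n" for n e
    using AnDiag_ob_rules[OF O(1)] that by (auto dest: symset_hom_delta_rules symset_hom_rules)
  moreover have "usnd U (d_t D n a) \<in> d_sorts D" if "a \<in> elts (d_A D) n" for n a
    using AnDiag_ob_rules[OF O(1)] that by (auto dest: symset_hom_delta_rules symset_hom_rules)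
  ultimately show "cmp (AnDiag U) X Y Z g f \<in> hom (AnDiag U) X Z"
    using * by (auto simp: AnDiag_simps AnDiag_hom_iff symset_hom_rules)
next
  fix X Y f assume *: "X \<in> ob (AnDiag U)" "Y \<in> ob (AnDiag U)" "f \<in> hom (AnDiag U) X Y"
  obtain D h D' h' f1 f2 f3 where
    XY [simp]: "X = (D, h)" "Y = (D', h')" "f = (f1, f2, f3)"
    by (cases X, cases Y, cases f)
  note X = AnDiag_ob_rules(6-8)[OF *(1)[unfolded XY]] and Y = AnDiag_ob_rules(6-8)[OF *(2)[unfolded XY]]
    and F = AnDiag_homD[OF *[unfolded XY]]
  show "cmp (AnDiag U) X X Y f (idn (AnDiag U) X) = f"
    using category_rules(3)[OF category_SymSet X(1) Y(1) F(1)] category_rules(3)[OF category_SymSet X(2) Y(2) F(2)]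
      category_rules(3)[OF category_SetC X(3) Y(3) F(3)] by (simp add: AnDiag_simps)
  show "cmp (AnDiag U) X Y Y (idn (AnDiag U) Y) f = f"
    using category_rules(4)[OF category_SymSet X(1) Y(1) F(1)] category_rules(4)[OF category_SymSet X(2) Y(2) F(2)]
      category_rules(4)[OF category_SetC X(3) Y(3) F(3)] by (simp add: AnDiag_simps)
next
  fix W X Y Z f g k
  assume *: "W \<in> ob (AnDiag U)" "X \<in> ob (AnDiag U)" "Y \<in> ob (AnDiag U)" "Z \<in> ob (AnDiag U)"
    "f \<in> hom (AnDiag U) W X" "g \<in> hom (AnDiag U) X Y" "k \<in> hom (AnDiag U) Y Z"
  obtain C c D d E e D' d' f1 f2 f3 g1 g2 g3 k1 k2 k3 where
    XY [simp]: "W = (C, c)" "X = (D, d)" "Y = (E, e)" "Z = (D', d')" "f = (f1, f2, f3)"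
      "g = (g1, g2, g3)" "k = (k1, k2, k3)"
    by (cases W, cases X, cases Y, cases Z, cases f, cases g, cases k)
  note A = *[unfolded XY]
  note W = AnDiag_ob_rules(6-8)[OF A(1)] and X = AnDiag_ob_rules(6-8)[OF A(2)]
    and Y = AnDiag_ob_rules(6-8)[OF A(3)] and Z = AnDiag_ob_rules(6-8)[OF A(4)]
    and F = AnDiag_homD[OF A(1,2,5)] and G = AnDiag_homD[OF A(2,3,6)] and K = AnDiag_homD[OF A(3,4,7)]
  show "cmp (AnDiag U) W Y Z k (cmp (AnDiag U) W X Y g f) = cmp (AnDiag U) W X Z (cmp (AnDiag U) X Y Z k g) f"
    using category_rules(5)[OF category_SymSet W(1) X(1) Y(1) Z(1) F(1) G(1) K(1)]
      category_rules(5)[OF category_SymSet W(2) X(2) Y(2) Z(2) F(2) G(2) K(2)]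
      category_rules(5)[OF category_SetC W(3) X(3) Y(3) Z(3) F(3) G(3) K(3)] by (simp add: AnDiag_simps)
qed

lemma p_and_simps: "fob p_and (D, h) = d_sorts D" "far p_and X Y (f, g, u) = u"
  by (simp_all add: p_and_def)

lemma functor_p_and: "is_functor (AnDiag U) (SetC U) p_and"
  unfolding is_functor_def
proof (intro conjI ballI)
  fix X assume "X \<in> ob (AnDiag U)"
  then show "fob p_and X \<in> ob (SetC U)" "far p_and X X (idn (AnDiag U) X) = idn (SetC U) (fob p_and X)"
    by (cases X; simp add: p_and_simps AnDiag_simps AnDiag_ob_rules)+
next
  fix X Y f assume "X \<in> ob (AnDiag U)" "Y \<in> ob (AnDiag U)" "f \<in> hom (AnDiag U) X Y"
  then show "far p_and X Y f \<in> hom (SetC U) (fob p_and X) (fob p_and Y)"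
    by (cases X; cases Y; cases f) (simp add: p_and_simps AnDiag_homD del: SetC_simps)
next
  fix X Y Z f g
  show "far p_and X Z (cmp (AnDiag U) X Y Z g f) =
     cmp (SetC U) (fob p_and X) (fob p_and Y) (fob p_and Z) (far p_and Y Z g) (far p_and X Y f)"
    by (cases X; cases Y; cases Z; cases f; cases g) (simp add: p_and_simps AnDiag_simps)
qed (rule category_AnDiag category_SetC)+

section \<open>The comparison functor\<close>

lemma iota_E_elts_iff: "e \<in> iota_E_elts U A n \<longleftrightarrow> (\<exists>a\<in>elts A n. \<exists>i\<in>{1..n}. e = pr a (nu i))"
  by (auto simp: iota_E_elts_def)

lemma pair_in_iota_E: "pr a (nu i) \<in> iota_E_elts U A n \<longleftrightarrow> a \<in> elts A n \<and> i \<in> {1..n}"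
  by (auto simp: iota_E_elts_def)

lemma ball_iota_E: "(\<forall>e\<in>iota_E_elts U A n. R e) \<longleftrightarrow> (\<forall>a\<in>elts A n. \<forall>i\<in>{1..n}. R (pr a (nu i)))"
  by (auto simp: iota_E_elts_iff)

lemma elts_iota_E: "elts (iota_E U A) = iota_E_elts U A"
  by (simp add: iota_E_def)

lemma act_iota_E:
  "a \<in> elts A n \<Longrightarrow> i \<in> {1..n} \<Longrightarrow> \<sigma> \<in> Sym n \<Longrightarrow>
   act (iota_E U A) n (pr a (nu i)) \<sigma> = pr (act A n a \<sigma>) (nu (inv \<sigma> i))"
  using pair_in_iota_E[of a i A n] by (simp add: iota_E_def)

lemma iota_E_ob:
  assumes A: "A \<in> ob (SymSet U)"
  shows "iota_E U A \<in> ob (SymSet U)"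
proof -
  have "symmetric_set (iota_E U A)"
    unfolding iota_E_def
    by (rule symmetric_setI)
      (use A in \<open>auto simp: iota_E_elts_iff symmetric_set_rules inv_Sym_comp
        inv_Sym_image[unfolded atLeastAtMost_iff One_nat_def]\<close>)
  moreover have "usmall U (iota_E_elts U A n)" for n
    by (rule small_subset[OF small_product[of "elts A n" "nu ` {1..n}"]])
      (use A in \<open>auto simp: iota_E_elts_iff small_finite\<close>)
  ultimately show ?thesis by (simp add: elts_iota_E)
qed

lemma iota_diag_simps:
  "d_sorts (iota_diag U X) = s_sorts X" "d_A (iota_diag U X) = s_ops X"
  "d_E (iota_diag U X) = iota_E U (s_ops X)"
  "e \<in> iota_E_elts U (s_ops X) n \<Longrightarrow> d_p (iota_diag U X) n e = ufst U e"
  "e \<in> iota_E_elts U (s_ops X) n \<Longrightarrow>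
     d_s (iota_diag U X) n e = pr (nu n) (s_typ X n (ufst U e) (unat U (usnd U e)))"
  "a \<in> elts (s_ops X) n \<Longrightarrow> d_t (iota_diag U X) n a = pr (nu n) (s_typ X n a 0)"
  by (simp_all add: iota_diag_def)

lemma iota_ob:
  assumes X: "X \<in> ob (Sig_s U)"
  shows "(iota_diag U X, iota_str U X) \<in> ob (AnDiag U)"
proof -
  note sym = Sig_ob_rules(1)[OF X]
  note img = inv_Sym_image[unfolded atLeastAtMost_iff One_nat_def]
  have E: "iota_E U (s_ops X) \<in> ob (SymSet U)"
    using Sig_obD(1)[OF X] by (rule iota_E_ob)
  have p: "d_p (iota_diag U X) \<in> symset_hom (iota_E U (s_ops X)) (s_ops X)"
    unfolding symset_hom_iff elts_iota_E ball_iota_E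
    using sym
    by (auto simp: iota_diag_simps pair_in_iota_E act_iota_E symmetric_set_rules img)
       (simp add: iota_diag_def)
  \<comment> \<open>The typing of a translated operation is composed with \<sigma> while its
    position moves by the inverse; the two cancel, so \<open>s\<close> is invariant.\<close>
  have inv: "s_typ X n a (\<sigma> (inv \<sigma> i)) = s_typ X n a i" if "\<sigma> \<in> Sym n" for n a i \<sigma>
    by (simp only: Sym_rules(4)[OF that])
  have s: "d_s (iota_diag U X) \<in> symset_hom (iota_E U (s_ops X)) (delta U (s_sorts X))"
    unfolding symset_hom_delta_iff elts_iota_E ball_iota_E
    using sym Sig_ob_rules(6,7)[OF X]
    by (auto simp: inv iota_diag_simps pair_in_iota_E act_iota_E symmetric_set_rules img)
       (simp add: iota_diag_def)
  \<comment> \<open>\<open>t\<close> is invariant since \<sigma> fixes the index 0.\<close>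
  have zero: "s_typ X n a (\<sigma> 0) = s_typ X n a 0" if "\<sigma> \<in> Sym n" for n a \<sigma>
    by (simp only: Sym_rules(1)[OF that])
  have t: "d_t (iota_diag U X) \<in> symset_hom (s_ops X) (delta U (s_sorts X))"
    unfolding symset_hom_delta_iff
    using sym Sig_ob_rules(6,7)[OF X]
    by (auto simp: zero iota_diag_simps symmetric_set_rules)
       (simp add: iota_diag_def)
  have "finite {e \<in> iota_E_elts U (s_ops X) n. d_p (iota_diag U X) n e = a}" for n a
    by (rule finite_subset[of _ "(\<lambda>i. pr a (nu i)) ` {1..n}"])
      (auto simp: iota_diag_simps iota_E_elts_iff pair_in_iota_E)
  then have "iota_diag U X \<in> ob (PsAnDiag U)"
    unfolding PsAnDiag_ob_iff iota_diag_simps(1-3) elts_iota_E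
    using E p s t Sig_obD(1)[OF X] Sig_ob_rules(3)[OF X] by simp
  moreover have "fst (snd (iota_str U X)) \<in> symset_hom (iota_E U (s_ops X)) (R_set U)"
    unfolding symset_hom_iff elts_iota_E ball_iota_E
    using sym
    by (auto simp: iota_str_def pair_in_iota_E act_iota_E symmetric_set_rules img elts_R act_R)
  moreover have "\<exists>!e. e \<in> iota_E_elts U (s_ops X) n \<and>
      fst (snd (iota_str U X)) n e = pr (nu n) (nu i) \<and> d_p (iota_diag U X) n e = a"
    if "i \<in> {1..n}" "a \<in> elts (s_ops X) n" for n i a
    by (rule ex1I[of _ "pr a (nu i)"])
      (use that in \<open>auto simp: iota_str_def iota_diag_simps iota_E_elts_iff pair_in_iota_E\<close>)
  ultimately show ?thesis
    unfolding AnDiag_ob_iff iota_diag_simps(1-3) elts_iota_E by (simp add: iota_str_def)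
qed

lemma pos_iota: "e \<in> iota_E_elts U (s_ops X) n \<Longrightarrow> pos (iota_str U X) n e = unat U (usnd U e)"
  by (simp add: pos_def iota_str_def)

lemma iota_s_simps:
  "fob (iota_s U) X = (iota_diag U X, iota_str U X)"
  "far (iota_s U) X Y (f, u) = (f, \<lambda>n. \<lambda>e\<in>iota_E_elts U (s_ops X) n. pr (f n (ufst U e)) (usnd U e), u)"
  by (simp_all add: iota_s_def)

text \<open>Compatibility of \<open>f\<close> with \<open>\<partial>\<close> splits into compatibility with \<open>t\<close> at the index \<open>0\<close> and with
  \<open>s\<close> at the other indices.\<close>

lemma iota_hom_iff:
  assumes X: "X \<in> ob (Sig_s U)" and Y: "Y \<in> ob (Sig_s U)"
  shows "(f, g, u) \<in> hom (AnDiag U) (fob (iota_s U) X) (fob (iota_s U) Y) \<longleftrightarrow>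
    (f, u) \<in> hom (Sig_s U) X Y \<and> far (iota_s U) X Y (f, u) = (f, g, u)" (is "?L \<longleftrightarrow> ?R")
proof
  note iff = AnDiag_hom_iff[OF iota_ob[OF X] iota_ob[OF Y], folded iota_s_simps(1)]
  let ?g = "\<lambda>n. \<lambda>e\<in>iota_E_elts U (s_ops X) n. pr (f n (ufst U e)) (usnd U e)"
  {
    assume ?L
    then have f: "f \<in> symset_hom (s_ops X) (s_ops Y)"
      and g: "g \<in> symset_hom (iota_E U (s_ops X)) (iota_E U (s_ops Y))"
      and u: "u \<in> s_sorts X \<rightarrow>\<^sub>E s_sorts Y"
      and s: "\<And>n e. e \<in> iota_E_elts U (s_ops X) n \<Longrightarrow>
         d_s (iota_diag U Y) n (g n e) = pr (nu n) (u (usnd U (d_s (iota_diag U X) n e)))"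
      and t: "\<And>n a. a \<in> elts (s_ops X) n \<Longrightarrow>
         d_t (iota_diag U Y) n (f n a) = pr (nu n) (u (usnd U (d_t (iota_diag U X) n a)))"
      and p: "\<And>n e. e \<in> iota_E_elts U (s_ops X) n \<Longrightarrow>
         d_p (iota_diag U Y) n (g n e) = f n (d_p (iota_diag U X) n e)"
      and pos: "\<And>n e. e \<in> iota_E_elts U (s_ops X) n \<Longrightarrow> pos (iota_str U Y) n (g n e) = pos (iota_str U X) n e"
      unfolding iff iota_diag_simps(1-3) elts_iota_E by blast+
    have gE: "g n e \<in> iota_E_elts U (s_ops Y) n" if "e \<in> iota_E_elts U (s_ops X) n" for n e
      using symset_hom_rules(1)[OF g, of e n] that by (simp add: elts_iota_E)
    \<comment> \<open>An element is determined by its operation and its position, and the equations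
      for \<open>p\<close> and \<open>pos\<close> prescribe both, so \<open>g\<close> is forced by
      \<open>f\<close>.\<close>
    have gv: "g n e = pr (f n (ufst U e)) (usnd U e)" if e: "e \<in> iota_E_elts U (s_ops X) n" for n e
      using p[OF e] pos[OF e] gE[OF e] e
      by (auto simp: iota_diag_simps pos_iota iota_E_elts_iff pair_in_iota_E)
    have "s_typ Y n (f n a) i = u (s_typ X n a i)" if a: "a \<in> elts (s_ops X) n" and i: "i \<le> n" for n a i
    proof (cases "i = 0")
      case True
      then show ?thesis using t[OF a] a symset_hom_rules(1)[OF f a] by (simp add: iota_diag_simps)
    next
      case False
      then have e: "pr a (nu i) \<in> iota_E_elts U (s_ops X) n" using a i by (simp add: pair_in_iota_E)
      show ?thesis using s[OF e] e gE[OF e] by (simp add: iota_diag_simps gv[OF e])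
    qed
    moreover have "?g = g"
      using g gv by (intro ext extensionalityI[of _ "iota_E_elts U (s_ops X) _"])
         (auto simp: symset_hom_iff elts_iota_E)
    ultimately show ?R using f u by (simp add: Sig_hom_iff[OF X Y] iota_s_simps)
  next
    assume R: ?R
    then have f: "f \<in> symset_hom (s_ops X) (s_ops Y)" and u: "u \<in> s_sorts X \<rightarrow>\<^sub>E s_sorts Y"
      and tp: "\<And>n a i. a \<in> elts (s_ops X) n \<Longrightarrow> i \<le> n \<Longrightarrow> s_typ Y n (f n a) i = u (s_typ X n a i)"
      and g: "g = ?g"
      by (auto simp: Sig_hom_iff[OF X Y] iota_s_simps)
    have ghom: "?g \<in> symset_hom (iota_E U (s_ops X)) (iota_E U (s_ops Y))"
      unfolding symset_hom_iff elts_iota_E ball_iota_E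
      using Sig_ob_rules(1)[OF X] symset_hom_rules[OF f]
      by (auto simp: pair_in_iota_E act_iota_E symmetric_set_rules
          inv_Sym_image[unfolded atLeastAtMost_iff One_nat_def])
    show ?L
      unfolding iff iota_diag_simps(1-3) elts_iota_E ball_iota_E g
      using f u ghom tp symset_hom_rules(1)[OF f]
      by (simp add: iota_diag_simps pair_in_iota_E pos_iota)
  }
qed

lemma iota_hom:
  assumes "X \<in> ob (Sig_s U)" "Y \<in> ob (Sig_s U)" "f \<in> hom (Sig_s U) X Y"
  shows "far (iota_s U) X Y f \<in> hom (AnDiag U) (fob (iota_s U) X) (fob (iota_s U) Y)"
proof -
  obtain f1 u where "f = (f1, u)" by (cases f)
  then show ?thesis
    using iota_hom_iff[OF assms(1,2), of f1 _ u] assms(3) by (simp add: iota_s_simps(2))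
qed

lemma functor_iota: "is_functor (Sig_s U) (AnDiag U) (iota_s U)"
  unfolding is_functor_def
proof (intro conjI ballI)
  fix X assume X: "X \<in> ob (Sig_s U)"
  show "fob (iota_s U) X \<in> ob (AnDiag U)"
    using iota_ob[OF X] by (simp add: iota_s_simps)
  have "(\<lambda>n. \<lambda>e\<in>iota_E_elts U (s_ops X) n. pr (idn (SymSet U) (s_ops X) n (ufst U e)) (usnd U e)) =
      idn (SymSet U) (iota_E U (s_ops X))"
    by (intro ext extensionalityI[of _ "iota_E_elts U (s_ops X) _"])
      (auto simp: elts_iota_E[symmetric], auto simp: elts_iota_E iota_E_elts_iff)
  then show "far (iota_s U) X X (idn (Sig_s U) X) = idn (AnDiag U) (fob (iota_s U) X)"
    by (simp add: iota_s_simps Sig_simps AnDiag_simps iota_diag_simps)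
next
  fix X Y Z f g
  assume *: "X \<in> ob (Sig_s U)" "Y \<in> ob (Sig_s U)" "Z \<in> ob (Sig_s U)"
    "f \<in> hom (Sig_s U) X Y" "g \<in> hom (Sig_s U) Y Z"
  obtain f1 u g1 v where fg: "f = (f1, u)" "g = (g1, v)" by (cases f, cases g)
  have f1: "f1 \<in> symset_hom (s_ops X) (s_ops Y)"
    using Sig_homD(1)[OF *(4)[unfolded fg]] by simp
  have "(\<lambda>n. \<lambda>e\<in>iota_E_elts U (s_ops X) n.
         pr (cmp (SymSet U) (s_ops X) (s_ops Y) (s_ops Z) g1 f1 n (ufst U e)) (usnd U e)) =
      cmp (SymSet U) (iota_E U (s_ops X)) (iota_E U (s_ops Y)) (iota_E U (s_ops Z))
        (\<lambda>n. \<lambda>e\<in>iota_E_elts U (s_ops Y) n. pr (g1 n (ufst U e)) (usnd U e))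
        (\<lambda>n. \<lambda>e\<in>iota_E_elts U (s_ops X) n. pr (f1 n (ufst U e)) (usnd U e))"
    using symset_hom_rules(1)[OF f1]
    by (intro ext extensionalityI[of _ "iota_E_elts U (s_ops X) _"])
      (auto simp: elts_iota_E[symmetric], auto simp: elts_iota_E iota_E_elts_iff)
  then show "far (iota_s U) X Z (cmp (Sig_s U) X Y Z g f) =
      cmp (AnDiag U) (fob (iota_s U) X) (fob (iota_s U) Y) (fob (iota_s U) Z)
        (far (iota_s U) Y Z g) (far (iota_s U) X Y f)"
    by (simp add: fg iota_s_simps Sig_simps AnDiag_simps iota_diag_simps)
qed (auto simp: category_Sig category_AnDiag iota_hom)

section \<open>Recovering a signature from an analytic diagram\<close>

definition signature_of :: "'u diag \<times> 'u diag_map \<Rightarrow> 'u sig" where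
  "signature_of X = (case X of (D, h) \<Rightarrow> \<lparr>
     s_ops = d_A D,
     s_typ = (\<lambda>n. \<lambda>a\<in>elts (d_A D) n. \<lambda>i\<in>{0..n}.
        if i = 0 then usnd U (d_t D n a) else usnd U (d_s D n (elem D h n a i))),
     s_sorts = d_sorts D \<rparr>)"

text \<open>Operations and sorts of \<open>signature_of X\<close> are those of the diagram itself,
  so the comparison is the identity on both and in particular vertical; only the elements of
  \<open>E\<close> are renamed.\<close>

definition counit_map :: "'u diag \<times> 'u diag_map \<Rightarrow> 'u diag_map" where
  "counit_map X = (case X of (D, h) \<Rightarrow> (idn (SymSet U) (d_A D),
     (\<lambda>n. \<lambda>e\<in>iota_E_elts U (d_A D) n. elem D h n (ufst U e) (unat U (usnd U e))),
     idn (SetC U) (d_sorts D)))"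

definition counit_inv :: "'u diag \<times> 'u diag_map \<Rightarrow> 'u diag_map" where
  "counit_inv X = (case X of (D, h) \<Rightarrow> (idn (SymSet U) (d_A D),
     (\<lambda>n. \<lambda>e\<in>elts (d_E D) n. pr (d_p D n e) (nu (pos h n e))),
     idn (SetC U) (d_sorts D)))"

text \<open>Equivariance of the recovered typing is checked at each index: at 0 by invariance of
  \<open>t\<close>, at a position by \<open>elem_act\<close> and invariance of \<open>s\<close>, and
  elsewhere because \<sigma> preserves \<open>{0..n}\<close>, so that both sides are
  \<open>undefined\<close>.\<close>

lemma signature_of_ob:
  assumes X: "(D, h) \<in> ob (AnDiag U)"
  shows "signature_of (D, h) \<in> ob (Sig_s U)"
proof -
  note rules = AnDiag_ob_rules[OF X]
  have "s_typ (signature_of (D, h)) \<in> symset_hom (d_A D) (dagger (d_sorts D))"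
    unfolding symset_hom_dagger_iff[OF rules(3)]
  proof (intro conjI allI ballI)
    fix n a assume a: "a \<in> elts (d_A D) n"
    show "s_typ (signature_of (D, h)) n a \<in> {0..n} \<rightarrow>\<^sub>E d_sorts D"
      using a symset_hom_delta_rules(1)[OF rules(11) a] symset_hom_delta_rules(1)[OF rules(10) elem_rules(1)[OF X a]]
      by (auto simp: signature_of_def)
    fix \<sigma> assume \<sigma>: "\<sigma> \<in> Sym n"
    have a': "act (d_A D) n a \<sigma> \<in> elts (d_A D) n" by (rule symmetric_set_rules(1)[OF rules(3) a \<sigma>])
    show "s_typ (signature_of (D, h)) n (act (d_A D) n a \<sigma>) = s_typ (signature_of (D, h)) n a \<circ> \<sigma>"
    proof
      fix i
      consider "i = 0" | "i \<in> {1..n}" | "i \<notin> {0..n}" by fastforce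
      then show "s_typ (signature_of (D, h)) n (act (d_A D) n a \<sigma>) i = (s_typ (signature_of (D, h)) n a \<circ> \<sigma>) i"
      proof cases
        case 1
        then show ?thesis
          using a a' Sym_rules(1)[OF \<sigma>] symset_hom_delta_rules(3)[OF rules(11) a \<sigma>] by (simp add: signature_of_def)
      next
        case 2
        then have \<sigma>i: "\<sigma> i \<in> {1..n}" using Sym_rules(2)[OF \<sigma>] by blast
        show ?thesis
          using a a' 2 \<sigma>i elem_act[OF X a 2 \<sigma>] symset_hom_delta_rules(3)[OF rules(10) elem_rules(1)[OF X a \<sigma>i] \<sigma>]
          by (simp add: signature_of_def)
      next
        case 3
        then have "\<sigma> i \<notin> {0..n}" using Sym_rules(3)[OF \<sigma>] by blast
        then show ?thesis using a a' 3 by (simp add: signature_of_def)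
      qed
    qed
  qed (simp add: signature_of_def)
  then show ?thesis using rules(2,6) by (simp add: Sig_s_def signature_of_def)
qed

text \<open>Pairs of an operation and a position are exchanged with the elements of \<open>E\<close>
  by \<open>elem\<close> in one direction and by \<open>d_p\<close> with \<open>pos\<close> in the
  other; these are mutually inverse and respect the actions.\<close>

lemma counit_rules:
  assumes X: "(D, h) \<in> ob (AnDiag U)"
  defines "I \<equiv> fob (iota_s U) (signature_of (D, h))"
  shows "counit_map (D, h) \<in> hom (AnDiag U) I (D, h)"
    and "counit_inv (D, h) \<in> hom (AnDiag U) (D, h) I"
    and "cmp (AnDiag U) (D, h) I (D, h) (counit_map (D, h)) (counit_inv (D, h)) = idn (AnDiag U) (D, h)"
    and "cmp (AnDiag U) I (D, h) I (counit_inv (D, h)) (counit_map (D, h)) = idn (AnDiag U) I"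
proof -
  let ?S = "signature_of (D, h)"
  note rules = AnDiag_ob_rules[OF X]
  note S = signature_of_ob[OF X]
  note I = iota_ob[OF S]
  have sig: "s_ops ?S = d_A D" "s_sorts ?S = d_sorts D" by (simp_all add: signature_of_def)
  let ?g = "\<lambda>n. \<lambda>e\<in>iota_E_elts U (d_A D) n. elem D h n (ufst U e) (unat U (usnd U e))"
  let ?k = "\<lambda>n. \<lambda>e\<in>elts (d_E D) n. pr (d_p D n e) (nu (pos h n e))"
  note pA = symset_hom_rules(1)[OF rules(9)] and pos = pos_rules(1)[OF X]
  have k: "?k n e \<in> iota_E_elts U (d_A D) n" if "e \<in> elts (d_E D) n" for n e
    using that pA pos by (simp add: pair_in_iota_E)
  have g: "?g \<in> symset_hom (iota_E U (d_A D)) (d_E D)"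
    unfolding symset_hom_iff elts_iota_E ball_iota_E
  proof (intro conjI allI ballI)
    fix n a i assume a: "a \<in> elts (d_A D) n" and i: "i \<in> {1..n}"
    show "?g n (pr a (nu i)) \<in> elts (d_E D) n"
      using a i elem_rules(1)[OF X a i] by (simp add: pair_in_iota_E)
    fix \<sigma> assume \<sigma>: "\<sigma> \<in> Sym n"
    have i': "inv \<sigma> i \<in> {1..n}" using i inv_Sym_image[OF \<sigma>] by blast
    show "?g n (act (iota_E U (d_A D)) n (pr a (nu i)) \<sigma>) = act (d_E D) n (?g n (pr a (nu i))) \<sigma>"
      using a i i' elem_act[OF X a i' \<sigma>] Sym_rules(4)[OF \<sigma>] symmetric_set_rules(1)[OF rules(3) a \<sigma>]
      by (simp add: pair_in_iota_E act_iota_E \<sigma>)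
  qed simp
  have khom: "?k \<in> symset_hom (d_E D) (iota_E U (d_A D))"
    unfolding symset_hom_iff elts_iota_E
  proof (intro conjI allI ballI)
    fix n e assume e: "e \<in> elts (d_E D) n"
    show "?k n e \<in> iota_E_elts U (d_A D) n" by (rule k[OF e])
    fix \<sigma> assume \<sigma>: "\<sigma> \<in> Sym n"
    show "?k n (act (d_E D) n e \<sigma>) = act (iota_E U (d_A D)) n (?k n e) \<sigma>"
      using e symmetric_set_rules(1)[OF rules(5) e \<sigma>] pos_rules(3)[OF X e \<sigma>] symset_hom_rules(2)[OF rules(9) e \<sigma>]
        act_iota_E[OF pA[OF e] pos[OF e] \<sigma>] by simp
  qed simp
  \<comment> \<open>Compatibility with \<open>s\<close> holds by construction, as the typing at a
    position was read off from \<open>s\<close> at the corresponding element; the code of the degree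
    is restored because \<open>s\<close> takes values in \<delta>.\<close>
  have s: "pr (nu n) (s_typ ?S n a i) = d_s D n (elem D h n a i)" if "a \<in> elts (d_A D) n" "i \<in> {1..n}" for n a i
    using that symset_hom_delta_rules(2)[OF rules(10) elem_rules(1)[OF X that]] by (simp add: signature_of_def)
  have t: "pr (nu n) (s_typ ?S n a 0) = d_t D n a" if "a \<in> elts (d_A D) n" for n a
    using that symset_hom_delta_rules(2)[OF rules(11) that] by (simp add: signature_of_def)
  have idns: "idn (SymSet U) (d_A D) \<in> symset_hom (d_A D) (d_A D)"
      "idn (SetC U) (d_sorts D) \<in> d_sorts D \<rightarrow>\<^sub>E d_sorts D"
    using rules(3) by (auto intro: idn_symset_hom)
  have comps: "cmp (SymSet U) (d_A D) (d_A D) (d_A D) (idn (SymSet U) (d_A D)) (idn (SymSet U) (d_A D)) = idn (SymSet U) (d_A D)"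
      "cmp (SetC U) (d_sorts D) (d_sorts D) (d_sorts D) (idn (SetC U) (d_sorts D)) (idn (SetC U) (d_sorts D)) = idn (SetC U) (d_sorts D)"
    using category_rules(3)[OF category_SymSet rules(6,6)] category_rules(3)[OF category_SetC rules(8,8)] idns by simp_all
  show "counit_map (D, h) \<in> hom (AnDiag U) I (D, h)"
    unfolding I_def iota_s_simps(1) counit_map_def prod.case AnDiag_hom_iff[OF I X]
      iota_diag_simps(1-3) sig elts_iota_E ball_iota_E
    using g idns s t elem_rules[OF X] symset_hom_delta_rules(1,2)[OF rules(10)] symset_hom_delta_rules(1,2)[OF rules(11)]
    by (simp add: iota_diag_simps sig pair_in_iota_E pos_iota)
  show "counit_inv (D, h) \<in> hom (AnDiag U) (D, h) I"
    unfolding I_def iota_s_simps(1) counit_inv_def prod.case AnDiag_hom_iff[OF X I]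
      iota_diag_simps(1-3) sig
    using khom idns k pA pos s t elem_unique[OF X] 
      symset_hom_delta_rules(1,2)[OF rules(10)] symset_hom_delta_rules(1,2)[OF rules(11)]
    by (simp add: iota_diag_simps sig pair_in_iota_E pos_iota)
  have "cmp (SymSet U) (d_E D) (iota_E U (d_A D)) (d_E D) ?g ?k = idn (SymSet U) (d_E D)"
    using k elem_unique[OF X] pA pos
    by (intro symset_hom_eqI[OF cmp_symset_hom[OF rules(5) khom g] idn_symset_hom[OF rules(5)]])
      (simp add: pair_in_iota_E)
  then show "cmp (AnDiag U) (D, h) I (D, h) (counit_map (D, h)) (counit_inv (D, h)) = idn (AnDiag U) (D, h)"
    by (simp add: I_def iota_s_simps counit_map_def counit_inv_def AnDiag_simps iota_diag_simps sig comps)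
  have symE: "symmetric_set (iota_E U (d_A D))" using iota_E_ob[OF rules(6)] by simp
  have "cmp (SymSet U) (iota_E U (d_A D)) (d_E D) (iota_E U (d_A D)) ?k ?g = idn (SymSet U) (iota_E U (d_A D))"
    using elem_rules[OF X] 
    by (intro symset_hom_eqI[OF cmp_symset_hom[OF symE g khom] idn_symset_hom[OF symE]])
      (auto simp: elts_iota_E iota_E_elts_iff pair_in_iota_E)
  then show "cmp (AnDiag U) I (D, h) I (counit_inv (D, h)) (counit_map (D, h)) = idn (AnDiag U) I"
    by (simp add: I_def iota_s_simps counit_map_def counit_inv_def AnDiag_simps iota_diag_simps sig comps)
qed

text \<open>Fullness is \<open>iota_hom_iff\<close>; faithfulness is visible in the definition,
  since \<open>iota_s\<close> leaves both components of an arrow in place.\<close>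

lemma vertical_equivalence_iota:
  "vertical_equivalence (Sig_s U) (AnDiag U) (SetC U) p_s p_and (iota_s U) signature_of counit_map counit_inv"
proof
  fix X assume X: "X \<in> ob (Sig_s U)"
  show "fob p_and (fob (iota_s U) X) = fob p_s X"
    by (simp add: iota_s_simps p_and_simps p_s_simps iota_diag_simps)
  fix Y assume Y: "Y \<in> ob (Sig_s U)"
  show "far p_and (fob (iota_s U) X) (fob (iota_s U) Y) (far (iota_s U) X Y f) = far p_s X Y f" for f
    by (cases f) (simp add: iota_s_simps p_and_simps p_s_simps)
  show "\<exists>h\<in>hom (Sig_s U) X Y. far (iota_s U) X Y h = k"
    if "k \<in> hom (AnDiag U) (fob (iota_s U) X) (fob (iota_s U) Y)" for k
    using that iota_hom_iff[OF X Y] by (cases k) blast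
  show "far (iota_s U) X Y h = far (iota_s U) X Y h' \<Longrightarrow> h = h'" for h h'
    by (cases h; cases h') (simp add: iota_s_simps)
next
  fix X assume "X \<in> ob (AnDiag U)"
  moreover obtain D h where [simp]: "X = (D, h)" by (cases X)
  ultimately have X: "(D, h) \<in> ob (AnDiag U)" by simp
  show "signature_of X \<in> ob (Sig_s U)" using signature_of_ob[OF X] by simp
  show "fob p_s (signature_of X) = fob p_and X"
    by (simp add: p_s_simps p_and_simps signature_of_def)
  show "far p_and (fob (iota_s U) (signature_of X)) X (counit_map X) = idn (SetC U) (fob p_and X)"
    by (simp add: counit_map_def p_and_simps)
  show "counit_map X \<in> hom (AnDiag U) (fob (iota_s U) (signature_of X)) X"
    "counit_inv X \<in> hom (AnDiag U) X (fob (iota_s U) (signature_of X))"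
    "cmp (AnDiag U) X (fob (iota_s U) (signature_of X)) X (counit_map X) (counit_inv X) = idn (AnDiag U) X"
    "cmp (AnDiag U) (fob (iota_s U) (signature_of X)) X (fob (iota_s U) (signature_of X)) (counit_inv X) (counit_map X)
       = idn (AnDiag U) (fob (iota_s U) (signature_of X))"
    using counit_rules[OF X] by simp_all
qed (rule fibration_p_s functor_p_and functor_iota)+

end

theorem proposition7p13:
  fixes U :: "'u univ"
  assumes "set_universe U"
  shows "equivalence_of_fibrations (Sig_s U) (AnDiag U) (SetC U) p_s p_and (iota_s U)"
proof -
  interpret small_sets U by unfold_locales (rule assms)
  show ?thesis
    by (rule vertical_equivalence.equivalence_of_fibrations[OF vertical_equivalence_iota])
qed

end
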